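(* The following assertion is false: "For every reductive homogeneous manifold $G/H$ with invariant Riemannian metric $g$ and $\mathfrak{m}$ the orthogonal complement of $\mathfrak{h}$ in $\mathfrak{g}$, every $X\in V$, every nonzero $Y\in\mathfrak{m}$ and every plane $P\subset\mathfrak{m}$ containing $Y$, the flag curvature of the flag $(P,Y)$ in $T_H(G/H)$ with respect to the invariant Randers metric $F_X$ is $$K(P,Y)=\frac{2\sqrt{g(Y,Y)}}{2\sqrt{g(Y,Y)}+g(X,Y)}\,K(P),\qquad K(P)=\frac{g([[Y,U]_{\mathfrak{h}},Y],U)}{g(U,U)g(Y,Y)-g(U,Y)^2},$$ where $K(P)$ is the sectional curvature of $P$ with respect to $g$ and $U$ is any vector in $P$ with $\mathrm{span}\{Y,U\}=P$."
   Context: $G$ is a connected Lie group with Lie algebra $\mathfrak{g}$, $H$ a closed subgroup with Lie algebra $\mathfrak{h}$, and $\mathrm{ad}(h)$ denotes the adjoint representation of $h\in H$ on $\mathfrak{g}$. $G/H$ is reductive if there is a subspace $\mathfrak{m}\subset\mathfrak{g}$ with $\mathfrak{g}=\mathfrak{h}+\mathfrak{m}$ (direct sum of vector subspaces) and $\mathrm{ad}(h)\mathfrak{m}\subset\mathfrak{m}$ for all $h\in H$ (for instance $H=\{e\}$, $\mathfrak{h}=0$, $\mathfrak{m}=\mathfrak{g}$ is allowed). Here $\mathfrak{m}$ is the orthogonal complement of $\mathfrak{h}$ with respect to the inner product on $\mathfrak{g}$, $\mathfrak{m}$ is identified with $T_H(G/H)$, and $g$ also denotes the inner product $\langle\cdot,\cdot\rangle$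 induced on $\mathfrak{m}$. $[Y,U]_{\mathfrak{h}}$ is the orthogonal projection of $[Y,U]$ to $\mathfrak{h}$. Put $$V=\{X\in\mathfrak{m}\mid \mathrm{ad}(h)X=X\ \text{for all } h\in H,\ \langle X,X\rangle<1\}.$$ For $X\in V$, let $\tilde X$ be the corresponding $G$-invariant vector field on $G/H$; the invariant Randers metric $F_X$ is $$F_X(xH,y)=\sqrt{g(xH)(y,y)}+g(xH)(\tilde X,y),\qquad y\in T_{xH}(G/H).$$ Flag curvature: for a Finsler metric $F$ and a nonzero tangent vector $Y$, put $g_Y(U,W)=\frac12\frac{\partial^2}{\partial s\,\partial t}F^2(Y+sU+tW)\big|_{s=t=0}$. For a plane $P=\mathrm{span}\{Y,U\}$ the flag curvature is $$K(P,Y)=\frac{g_Y(R_Y(U),U)}{g_Y(Y,Y)\,g_Y(U,U)-g_Y(Y,U)^2},$$ where $R_Y$ is the Riemann curvature operator (in direction $Y$) of the Chern connection of $F$. When $F$ is Riemannian, the flag curvature is the sectional curvature. *)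

theory Defs
  imports
    "HOL-Analysis.Analysis"
    "HOL-Algebra.Left_Coset"
    "HOL-Library.Function_Algebras"
begin

text \<open>Pointwise vector space structure on real functions (used for coordinate vectors and for
  tangent vectors, which are functionals on functions).\<close>

instantiation "fun" :: (type, real_vector) real_vector
begin

definition scaleR_fun :: "real \<Rightarrow> ('a \<Rightarrow> 'b) \<Rightarrow> 'a \<Rightarrow> 'b"
  where "scaleR_fun c f = (\<lambda>x. c *\<^sub>R f x)"

instance
  by standard (simp_all add: scaleR_fun_def fun_eq_iff algebra_simps)

end


section \<open>Smooth functions of n real variables\<close>

text \<open>Points of n-space are the sequences vanishing from index n on, as in
  \<^const>\<open>Euclidean_space\<close>; this allows the dimension to be quantified over.\<close>

type_synonym coord = "nat \<Rightarrow> real"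

definition pd :: "nat \<Rightarrow> (coord \<Rightarrow> real) \<Rightarrow> coord \<Rightarrow> real"
  where "pd i f x = deriv (\<lambda>t. f (x(i := t))) (x i)"

primrec Ck_on :: "nat \<Rightarrow> nat \<Rightarrow> coord set \<Rightarrow> (coord \<Rightarrow> real) \<Rightarrow> bool" where
  "Ck_on n 0 S f \<longleftrightarrow> continuous_map (subtopology (Euclidean_space n) S) euclideanreal f"
| "Ck_on n (Suc k) S f \<longleftrightarrow>
     continuous_map (subtopology (Euclidean_space n) S) euclideanreal f \<and>
     (\<forall>i<n. (\<forall>x\<in>S. (\<lambda>t. f (x(i := t))) field_differentiable at (x i)) \<and> Ck_on n k S (pd i f))"

definition smooth_on :: "nat \<Rightarrow> coord set \<Rightarrow> (coord \<Rightarrow> real) \<Rightarrow> bool"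
  where "smooth_on n S f \<longleftrightarrow> (\<forall>k. Ck_on n k S f)"


section \<open>Smooth manifolds\<close>

text \<open>A chart is a pair of its domain and its coordinate map. The atlas of a manifold need not be
  maximal.\<close>

type_synonym 'a chart = "'a set \<times> ('a \<Rightarrow> coord)"

record 'a mfd =
  mtop :: "'a topology"
  mdim :: nat
  atlas :: "'a chart set"

abbreviation chart_inv :: "'a chart \<Rightarrow> coord \<Rightarrow> 'a"
  where "chart_inv c \<equiv> inv_into (fst c) (snd c)"

definition smooth_manifold :: "'a mfd \<Rightarrow> bool" where
  "smooth_manifold M \<longleftrightarrow>
     Hausdorff_space (mtop M) \<and>
     (\<exists>\<B>. countable \<B> \<and> (\<forall>B\<in>\<B>. openin (mtop M) B) \<and>
        (\<forall>W p. openin (mtop M) W \<and> p \<in> W \<longrightarrow> (\<exists>B\<in>\<B>. p \<in> B \<and> B \<subseteq> W))) \<and>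
     (\<Union>c\<in>atlas M. fst c) = topspace (mtop M) \<and>
     (\<forall>(U, \<phi>)\<in>atlas M.
        openin (mtop M) U \<and> openin (Euclidean_space (mdim M)) (\<phi> ` U) \<and>
        homeomorphic_map (subtopology (mtop M) U)
          (subtopology (Euclidean_space (mdim M)) (\<phi> ` U)) \<phi>) \<and>
     (\<forall>(U, \<phi>)\<in>atlas M. \<forall>(V, \<psi>)\<in>atlas M. \<forall>i<mdim M.
        smooth_on (mdim M) (\<phi> ` (U \<inter> V)) (\<lambda>x. \<psi> (inv_into U \<phi> x) i))"

definition smooth_map :: "'a mfd \<Rightarrow> 'b mfd \<Rightarrow> ('a \<Rightarrow> 'b) \<Rightarrow> bool" where
  "smooth_map M N f \<longleftrightarrow>
     continuous_map (mtop M) (mtop N) f \<and>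
     (\<forall>(U, \<phi>)\<in>atlas M. \<forall>(V, \<psi>)\<in>atlas N. \<forall>i<mdim N.
        smooth_on (mdim M) (\<phi> ` {p \<in> U. f p \<in> V}) (\<lambda>x. \<psi> (f (inv_into U \<phi> x)) i))"

definition Cinf :: "'a mfd \<Rightarrow> ('a \<Rightarrow> real) set" where
  "Cinf M = {f. \<forall>(U, \<phi>)\<in>atlas M. smooth_on (mdim M) (\<phi> ` U) (\<lambda>x. f (inv_into U \<phi> x))}"

definition prod_mfd :: "'a mfd \<Rightarrow> 'b mfd \<Rightarrow> ('a \<times> 'b) mfd" where
  "prod_mfd M N =
     \<lparr>mtop = prod_topology (mtop M) (mtop N), mdim = mdim M + mdim N,
      atlas = {(U \<times> V, \<lambda>(p, q) i. if i < mdim M then \<phi> p i else \<psi> q (i - mdim M)) |U \<phi> V \<psi>.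
        (U, \<phi>) \<in> atlas M \<and> (V, \<psi>) \<in> atlas N}\<rparr>"

definition line_mfd :: "real mfd" where
  "line_mfd = \<lparr>mtop = euclideanreal, mdim = 1,
     atlas = {(UNIV, \<lambda>t i. if i = 0 then t else 0)}\<rparr>"


section \<open>Tangent vectors\<close>

text \<open>Tangent vectors are point derivations of the algebra of smooth functions; they are
  normalised to be 0 on all other functions so that equality is equality on smooth functions.\<close>

type_synonym 'a tvec = "('a \<Rightarrow> real) \<Rightarrow> real"

definition tangent :: "'a mfd \<Rightarrow> 'a \<Rightarrow> 'a tvec set" where
  "tangent M p = {v.
     (\<forall>f. f \<notin> Cinf M \<longrightarrow> v f = 0) \<and>
     (\<forall>f\<in>Cinf M. \<forall>h\<in>Cinf M. \<forall>a b. v (\<lambda>q. a * f q + b * h q) = a * v f + b * v h) \<and>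
     (\<forall>f\<in>Cinf M. \<forall>h\<in>Cinf M. v (\<lambda>q. f q * h q) = f p * v h + h p * v f)}"

definition differential :: "'b mfd \<Rightarrow> ('a \<Rightarrow> 'b) \<Rightarrow> 'a tvec \<Rightarrow> 'b tvec" where
  "differential N F v = (\<lambda>f. if f \<in> Cinf N then v (\<lambda>p. f (F p)) else 0)"

definition velocity :: "'a mfd \<Rightarrow> (real \<Rightarrow> 'a) \<Rightarrow> 'a tvec" where
  "velocity M \<gamma> = (\<lambda>f. if f \<in> Cinf M then deriv (\<lambda>t. f (\<gamma> t)) 0 else 0)"

text \<open>The vector with components \<open>y\<close> in the coordinate basis of the chart \<open>c\<close> at the point with
  coordinates \<open>x\<close>, and conversely the components of a tangent vector at \<open>p\<close>.\<close>

definition coord_vec :: "'a mfd \<Rightarrow> 'a chart \<Rightarrow> coord \<Rightarrow> nat \<Rightarrow> 'a tvec" where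
  "coord_vec M c x i = (\<lambda>f. if f \<in> Cinf M then pd i (\<lambda>x'. f (chart_inv c x')) x else 0)"

definition of_components :: "'a mfd \<Rightarrow> 'a chart \<Rightarrow> coord \<Rightarrow> coord \<Rightarrow> 'a tvec" where
  "of_components M c x y = (\<Sum>i<mdim M. y i *\<^sub>R coord_vec M c x i)"

definition components :: "'a mfd \<Rightarrow> 'a chart \<Rightarrow> 'a \<Rightarrow> 'a tvec \<Rightarrow> coord" where
  "components M c p v =
     (THE y. (\<forall>i\<ge>mdim M. y i = 0) \<and> of_components M c (snd c p) y = v)"

definition inner_product_on :: "'v::real_vector set \<Rightarrow> ('v \<Rightarrow> 'v \<Rightarrow> real) \<Rightarrow> bool" where
  "inner_product_on V b \<longleftrightarrow>
     (\<forall>u\<in>V. \<forall>v\<in>V. b u v = b v u) \<and>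
     (\<forall>u\<in>V. \<forall>v\<in>V. \<forall>w\<in>V. \<forall>r s. b (r *\<^sub>R u + s *\<^sub>R v) w = r * b u w + s * b v w) \<and>
     (\<forall>v\<in>V. v \<noteq> 0 \<longrightarrow> b v v > 0)"

definition riemannian_metric :: "'a mfd \<Rightarrow> ('a \<Rightarrow> 'a tvec \<Rightarrow> 'a tvec \<Rightarrow> real) \<Rightarrow> bool" where
  "riemannian_metric M g \<longleftrightarrow>
     (\<forall>p\<in>topspace (mtop M). inner_product_on (tangent M p) (g p)) \<and>
     (\<forall>c\<in>atlas M. \<forall>i<mdim M. \<forall>j<mdim M.
        smooth_on (mdim M) (snd c ` fst c)
          (\<lambda>x. g (chart_inv c x) (coord_vec M c x i) (coord_vec M c x j)))"


section \<open>Curvature\<close>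

text \<open>Upper and lower indices are written in the order in which they are read, so
  \<open>\<Gamma> i j k\<close> is the coefficient with upper index \<open>i\<close> and lower indices \<open>j\<close>, \<open>k\<close>.\<close>

definition inverse_matrix :: "nat \<Rightarrow> (nat \<Rightarrow> nat \<Rightarrow> real) \<Rightarrow> nat \<Rightarrow> nat \<Rightarrow> real" where
  "inverse_matrix n a = (THE b.
     (\<forall>i<n. \<forall>j<n. (\<Sum>k<n. a i k * b k j) = (if i = j then 1 else 0)) \<and>
     (\<forall>i j. i \<ge> n \<or> j \<ge> n \<longrightarrow> b i j = 0))"

definition christoffel ::
    "nat \<Rightarrow> (coord \<Rightarrow> nat \<Rightarrow> nat \<Rightarrow> real) \<Rightarrow> coord \<Rightarrow> nat \<Rightarrow> nat \<Rightarrow> nat \<Rightarrow> real" where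
  "christoffel n g x i j k = (\<Sum>s<n. inverse_matrix n (g x) i s / 2 *
     (pd k (\<lambda>x. g x s j) x - pd s (\<lambda>x. g x j k) x + pd j (\<lambda>x. g x k s) x))"

subsection \<open>Sectional curvature\<close>

text \<open>\<open>levi_civita_curvature n g x i j k l\<close> is the \<open>i\<close>-th component of
  \<open>R(\<partial>\<^sub>k, \<partial>\<^sub>l) \<partial>\<^sub>j\<close>, where \<open>R(u, v) = [\<nabla>\<^sub>u, \<nabla>\<^sub>v] - \<nabla>\<^bsub>[u, v]\<^esub>\<close>.\<close>

definition levi_civita_curvature ::
    "nat \<Rightarrow> (coord \<Rightarrow> nat \<Rightarrow> nat \<Rightarrow> real) \<Rightarrow> coord \<Rightarrow> nat \<Rightarrow> nat \<Rightarrow> nat \<Rightarrow> nat \<Rightarrow> real" where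
  "levi_civita_curvature n g x i j k l =
     pd k (\<lambda>x. christoffel n g x i j l) x - pd l (\<lambda>x. christoffel n g x i j k) x
     + (\<Sum>h<n. christoffel n g x i h k * christoffel n g x h j l
              - christoffel n g x i h l * christoffel n g x h j k)"

text \<open>Both curvatures below do not depend on the chart around \<open>p\<close>.\<close>

definition chart_at :: "'a mfd \<Rightarrow> 'a \<Rightarrow> 'a chart" where
  "chart_at M p = (SOME c. c \<in> atlas M \<and> p \<in> fst c)"

definition sectional_curvature ::
    "'a mfd \<Rightarrow> ('a \<Rightarrow> 'a tvec \<Rightarrow> 'a tvec \<Rightarrow> real) \<Rightarrow> 'a \<Rightarrow> 'a tvec \<Rightarrow> 'a tvec \<Rightarrow> real" where
  "sectional_curvature M g p Y U =
    (let n = mdim M; c = chart_at M p; x = snd c p;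
         y = components M c p Y; u = components M c p U;
         gc = (\<lambda>x i j. g (chart_inv c x) (coord_vec M c x i) (coord_vec M c x j));
         RUYY = of_components M c x
           (\<lambda>i. \<Sum>j<n. \<Sum>k<n. \<Sum>l<n. y j * levi_civita_curvature n gc x i j k l * u k * y l)
     in g p RUYY U / (g p Y Y * g p U U - (g p Y U)\<^sup>2))"

subsection \<open>Chern connection and flag curvature\<close>

definition fundamental_tensor :: "('v::real_vector \<Rightarrow> real) \<Rightarrow> 'v \<Rightarrow> 'v \<Rightarrow> 'v \<Rightarrow> real" where
  "fundamental_tensor F Y U W =
     deriv (\<lambda>s. deriv (\<lambda>t. (F (Y + s *\<^sub>R U + t *\<^sub>R W))\<^sup>2) 0) 0 / 2"

text \<open>Below \<open>g x y\<close> is the matrix of the fundamental tensor at the vector with components \<open>y\<close> at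
  \<open>x\<close>, in the coordinates \<open>(x, y)\<close> of the tangent bundle. With the Cartan tensor
  \<open>C\<^sub>i\<^sub>j\<^sub>k = (1/2) \<partial>g\<^sub>i\<^sub>j/\<partial>y\<^sup>k\<close> and the formal Christoffel symbols \<open>\<gamma>\<close> of \<open>g\<close>, the nonlinear
  connection is \<open>N\<^sup>i\<^sub>j = \<gamma>\<^sup>i\<^sub>j\<^sub>k y\<^sup>k - C\<^sup>i\<^sub>j\<^sub>k \<gamma>\<^sup>k\<^sub>r\<^sub>s y\<^sup>r y\<^sup>s\<close> and
  \<open>\<delta>\<^sub>k = \<partial>/\<partial>x\<^sup>k - N\<^sup>j\<^sub>k \<partial>/\<partial>y\<^sup>j\<close>
  (Bao, Chern, Shen, An Introduction to Riemann-Finsler Geometry, Chapter 2).\<close>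

type_synonym finsler_matrix = "coord \<Rightarrow> coord \<Rightarrow> nat \<Rightarrow> nat \<Rightarrow> real"

definition cartan :: "finsler_matrix \<Rightarrow> coord \<Rightarrow> coord \<Rightarrow> nat \<Rightarrow> nat \<Rightarrow> nat \<Rightarrow> real" where
  "cartan g x y i j k = pd k (\<lambda>y. g x y i j) y / 2"

definition formal_christoffel ::
    "nat \<Rightarrow> finsler_matrix \<Rightarrow> coord \<Rightarrow> coord \<Rightarrow> nat \<Rightarrow> nat \<Rightarrow> nat \<Rightarrow> real" where
  "formal_christoffel n g x y = christoffel n (\<lambda>x. g x y) x"

definition nonlinear_connection ::
    "nat \<Rightarrow> finsler_matrix \<Rightarrow> coord \<Rightarrow> coord \<Rightarrow> nat \<Rightarrow> nat \<Rightarrow> real" where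
  "nonlinear_connection n g x y i j =
     (\<Sum>k<n. formal_christoffel n g x y i j k * y k)
     - (\<Sum>k<n. \<Sum>l<n. \<Sum>r<n. \<Sum>s<n. inverse_matrix n (g x y) i l * cartan g x y l j k
          * formal_christoffel n g x y k r s * y r * y s)"

definition horizontal_deriv ::
    "nat \<Rightarrow> finsler_matrix \<Rightarrow> nat \<Rightarrow> (coord \<Rightarrow> coord \<Rightarrow> real) \<Rightarrow> coord \<Rightarrow> coord \<Rightarrow> real" where
  "horizontal_deriv n g k f x y =
     pd k (\<lambda>x. f x y) x - (\<Sum>j<n. nonlinear_connection n g x y j k * pd j (f x) y)"

definition chern_connection ::
    "nat \<Rightarrow> finsler_matrix \<Rightarrow> coord \<Rightarrow> coord \<Rightarrow> nat \<Rightarrow> nat \<Rightarrow> nat \<Rightarrow> real" where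
  "chern_connection n g x y i j k = (\<Sum>s<n. inverse_matrix n (g x y) i s / 2 *
     (horizontal_deriv n g k (\<lambda>x y. g x y s j) x y
      - horizontal_deriv n g s (\<lambda>x y. g x y j k) x y
      + horizontal_deriv n g j (\<lambda>x y. g x y k s) x y))"

text \<open>The two structure equations that characterise the Chern connection: it is torsion free and
  almost compatible with the fundamental tensor.\<close>

lemma chern_connection_torsion_free:
  assumes "\<And>x y i j. g x y i j = g x y j i"
  shows "chern_connection n g x y i j k = chern_connection n g x y i k j"
proof -
  have "horizontal_deriv n g a (\<lambda>x y. g x y b c) x y = horizontal_deriv n g a (\<lambda>x y. g x y c b) x y"
    for a b c
    using assms by presburger
  then show ?thesis
    unfolding chern_connection_def by (intro sum.cong refl) (simp add: algebra_simps)
qed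

lemma chern_connection_almost_compatible:
  assumes sym: "\<And>x y i j. g x y i j = g x y j i"
    and inv: "\<And>i j. i < n \<Longrightarrow> j < n \<Longrightarrow>
      (\<Sum>k<n. g x y i k * inverse_matrix n (g x y) k j) = (if i = j then 1 else 0)"
    and "i < n" "j < n"
  shows "horizontal_deriv n g k (\<lambda>x y. g x y i j) x y =
    (\<Sum>l<n. g x y l j * chern_connection n g x y l i k) +
    (\<Sum>l<n. g x y i l * chern_connection n g x y l j k)"
proof -
  define D where "D a b c = horizontal_deriv n g a (\<lambda>x y. g x y b c) x y" for a b c
  have D_sym: "D a b c = D a c b" for a b c
    unfolding D_def using sym by presburger
  have lower: "(\<Sum>l<n. g x y a l * chern_connection n g x y l b k) = (D k a b - D a b k + D b k a) / 2"
    if "a < n" for a b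
  proof -
    have "(\<Sum>l<n. g x y a l * chern_connection n g x y l b k) =
      (\<Sum>l<n. \<Sum>s<n. (g x y a l * inverse_matrix n (g x y) l s) * ((D k s b - D s b k + D b k s) / 2))"
      unfolding chern_connection_def D_def[symmetric] by (simp add: sum_distrib_left mult_ac)
    also have "\<dots> = (\<Sum>s<n. (\<Sum>l<n. g x y a l * inverse_matrix n (g x y) l s)
        * ((D k s b - D s b k + D b k s) / 2))"
      by (subst sum.swap) (simp only: sum_distrib_right)
    also have "\<dots> = (\<Sum>s<n. if a = s then (D k s b - D s b k + D b k s) / 2 else 0)"
      using inv that by (intro sum.cong) auto
    finally show ?thesis using that by simp
  qed
  have "(\<Sum>l<n. g x y l j * chern_connection n g x y l i k) =
      (\<Sum>l<n. g x y j l * chern_connection n g x y l i k)"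
    using sym by simp
  then show ?thesis
    using lower[OF \<open>i < n\<close>, of j] lower[OF \<open>j < n\<close>, of i] D_sym[of k i j] D_sym[of i j k] D_sym[of j i k]
    by (simp add: D_def[symmetric])
qed

text \<open>The hh-curvature of the Chern connection, indexed as \<^const>\<open>levi_civita_curvature\<close>.\<close>

definition chern_curvature ::
    "nat \<Rightarrow> finsler_matrix \<Rightarrow> coord \<Rightarrow> coord \<Rightarrow> nat \<Rightarrow> nat \<Rightarrow> nat \<Rightarrow> nat \<Rightarrow> real" where
  "chern_curvature n g x y i j k l =
     horizontal_deriv n g k (\<lambda>x y. chern_connection n g x y i j l) x y
     - horizontal_deriv n g l (\<lambda>x y. chern_connection n g x y i j k) x y
     + (\<Sum>h<n. chern_connection n g x y i h k * chern_connection n g x y h j l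
              - chern_connection n g x y i h l * chern_connection n g x y h j k)"

definition flag_curvature ::
    "'a mfd \<Rightarrow> ('a \<Rightarrow> 'a tvec \<Rightarrow> real) \<Rightarrow> 'a \<Rightarrow> 'a tvec \<Rightarrow> 'a tvec \<Rightarrow> real" where
  "flag_curvature M F p Y U =
    (let n = mdim M; c = chart_at M p; x = snd c p;
         y = components M c p Y; u = components M c p U;
         gc = (\<lambda>x y i j. fundamental_tensor (F (chart_inv c x)) (of_components M c x y)
                 (coord_vec M c x i) (coord_vec M c x j));
         R\<^sub>YU = of_components M c x
           (\<lambda>i. \<Sum>j<n. \<Sum>k<n. \<Sum>l<n. y j * chern_curvature n gc x y i j k l * u k * y l);
         gY = fundamental_tensor (F p) Y
     in gY R\<^sub>YU U / (gY Y Y * gY U U - (gY Y U)\<^sup>2))"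


section \<open>Lie groups and reductive homogeneous spaces\<close>

definition lie_group :: "'a monoid \<Rightarrow> 'a mfd \<Rightarrow> bool" where
  "lie_group G M \<longleftrightarrow>
     group G \<and> smooth_manifold M \<and> topspace (mtop M) = carrier G \<and>
     smooth_map (prod_mfd M M) M (\<lambda>(a, b). a \<otimes>\<^bsub>G\<^esub> b) \<and>
     smooth_map M M (\<lambda>a. inv\<^bsub>G\<^esub> a)"

abbreviation lie_algebra :: "'a monoid \<Rightarrow> 'a mfd \<Rightarrow> 'a tvec set" where
  "lie_algebra G M \<equiv> tangent M \<one>\<^bsub>G\<^esub>"

text \<open>The value at the identity of the commutator of the left invariant vector fields extending
  \<open>X\<close> and \<open>Y\<close>; the left invariant extension of \<open>X\<close> sends \<open>f\<close> to \<open>\<lambda>a. X (\<lambda>b. f (a b))\<close>.\<close>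

definition lie_bracket :: "'a monoid \<Rightarrow> 'a mfd \<Rightarrow> 'a tvec \<Rightarrow> 'a tvec \<Rightarrow> 'a tvec" where
  "lie_bracket G M X Y = (\<lambda>f. if f \<in> Cinf M
     then X (\<lambda>a. Y (\<lambda>b. f (a \<otimes>\<^bsub>G\<^esub> b))) - Y (\<lambda>a. X (\<lambda>b. f (a \<otimes>\<^bsub>G\<^esub> b))) else 0)"

definition Ad :: "'a monoid \<Rightarrow> 'a mfd \<Rightarrow> 'a \<Rightarrow> 'a tvec \<Rightarrow> 'a tvec" where
  "Ad G M h = differential M (\<lambda>a. h \<otimes>\<^bsub>G\<^esub> a \<otimes>\<^bsub>G\<^esub> inv\<^bsub>G\<^esub> h)"

text \<open>The Lie algebra of a closed subgroup \<open>H\<close>: all \<open>v\<close> with \<open>exp(t v) \<in> H\<close> for all \<open>t\<close>, where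
  \<open>t \<mapsto> exp(t v)\<close> is the one-parameter subgroup with initial velocity \<open>v\<close>.\<close>

definition subgroup_lie_algebra :: "'a monoid \<Rightarrow> 'a mfd \<Rightarrow> 'a set \<Rightarrow> 'a tvec set" where
  "subgroup_lie_algebra G M H = {velocity M \<gamma> |\<gamma>.
     smooth_map line_mfd M \<gamma> \<and> (\<forall>s t. \<gamma> (s + t) = \<gamma> s \<otimes>\<^bsub>G\<^esub> \<gamma> t) \<and> range \<gamma> \<subseteq> H}"

definition coset_proj :: "'a monoid \<Rightarrow> 'a set \<Rightarrow> 'a \<Rightarrow> 'a set" where
  "coset_proj G H a = a <#\<^bsub>G\<^esub> H"

text \<open>\<open>Q\<close> is the set of left cosets with the quotient topology and the (unique) smooth structure
  for which the projection is a submersion.\<close>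

definition homogeneous_manifold :: "'a monoid \<Rightarrow> 'a mfd \<Rightarrow> 'a set \<Rightarrow> 'a set mfd \<Rightarrow> bool" where
  "homogeneous_manifold G M H Q \<longleftrightarrow>
     smooth_manifold Q \<and> topspace (mtop Q) = lcosets\<^bsub>G\<^esub> H \<and>
     quotient_map (mtop M) (mtop Q) (coset_proj G H) \<and>
     smooth_map M Q (coset_proj G H) \<and>
     (\<forall>a\<in>carrier G. differential Q (coset_proj G H) ` tangent M a = tangent Q (coset_proj G H a))"

definition reductive_decomposition ::
    "'a monoid \<Rightarrow> 'a mfd \<Rightarrow> 'a set \<Rightarrow> 'a tvec set \<Rightarrow> bool" where
  "reductive_decomposition G M H \<mm> \<longleftrightarrow>
     subspace \<mm> \<and> \<mm> \<subseteq> lie_algebra G M \<and>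
     subgroup_lie_algebra G M H \<inter> \<mm> = {0} \<and>
     lie_algebra G M = {Z + W |Z W. Z \<in> subgroup_lie_algebra G M H \<and> W \<in> \<mm>} \<and>
     (\<forall>h\<in>H. Ad G M h ` \<mm> \<subseteq> \<mm>)"

definition orth_complement ::
    "'a monoid \<Rightarrow> 'a mfd \<Rightarrow> 'a set \<Rightarrow> ('a tvec \<Rightarrow> 'a tvec \<Rightarrow> real) \<Rightarrow> 'a tvec set" where
  "orth_complement G M H ip =
     {W \<in> lie_algebra G M. \<forall>Z\<in>subgroup_lie_algebra G M H. ip Z W = 0}"

definition proj_h ::
    "'a monoid \<Rightarrow> 'a mfd \<Rightarrow> 'a set \<Rightarrow> ('a tvec \<Rightarrow> 'a tvec \<Rightarrow> real) \<Rightarrow> 'a tvec \<Rightarrow> 'a tvec" where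
  "proj_h G M H ip W =
     (THE Z. Z \<in> subgroup_lie_algebra G M H \<and> W - Z \<in> orth_complement G M H ip)"

definition translation :: "'a monoid \<Rightarrow> 'a \<Rightarrow> 'a set \<Rightarrow> 'a set" where
  "translation G a \<xi> = a <#\<^bsub>G\<^esub> \<xi>"

definition invariant_metric ::
    "'a monoid \<Rightarrow> 'a set mfd \<Rightarrow> ('a set \<Rightarrow> 'a set tvec \<Rightarrow> 'a set tvec \<Rightarrow> real) \<Rightarrow> bool" where
  "invariant_metric G Q g \<longleftrightarrow>
     (\<forall>a\<in>carrier G. \<forall>\<xi>\<in>topspace (mtop Q). \<forall>v\<in>tangent Q \<xi>. \<forall>w\<in>tangent Q \<xi>.
        g (translation G a \<xi>) (differential Q (translation G a) v) (differential Q (translation G a) w)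
        = g \<xi> v w)"

text \<open>The map \<open>X \<mapsto> d\<pi>(X)\<close> that identifies the complement \<open>\<mm>\<close> with the tangent space of \<open>G/H\<close>
  at the base point \<open>H\<close>.\<close>

abbreviation tangent_proj :: "'a monoid \<Rightarrow> 'a set \<Rightarrow> 'a set mfd \<Rightarrow> 'a tvec \<Rightarrow> 'a set tvec" where
  "tangent_proj G H Q \<equiv> differential Q (coset_proj G H)"

text \<open>\<open>g\<close> is an invariant Riemannian metric on the reductive homogeneous manifold \<open>Q = G/H\<close>, the
  complement being orthogonal with respect to the inner product \<open>ip\<close> on the Lie algebra, and \<open>g\<close>
  at the base point is the restriction of \<open>ip\<close> to that complement.\<close>

definition reductive_riemannian ::
    "'a monoid \<Rightarrow> 'a mfd \<Rightarrow> 'a set \<Rightarrow> 'a set mfd \<Rightarrow> ('a tvec \<Rightarrow> 'a tvec \<Rightarrow> real) \<Rightarrow>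
     ('a set \<Rightarrow> 'a set tvec \<Rightarrow> 'a set tvec \<Rightarrow> real) \<Rightarrow> bool" where
  "reductive_riemannian G M H Q ip g \<longleftrightarrow>
     lie_group G M \<and> connected_space (mtop M) \<and>
     subgroup H G \<and> closedin (mtop M) H \<and>
     homogeneous_manifold G M H Q \<and>
     inner_product_on (lie_algebra G M) ip \<and>
     reductive_decomposition G M H (orth_complement G M H ip) \<and>
     riemannian_metric Q g \<and> invariant_metric G Q g \<and>
     (\<forall>v\<in>orth_complement G M H ip. \<forall>w\<in>orth_complement G M H ip.
        g H (tangent_proj G H Q v) (tangent_proj G H Q w) = ip v w)"

definition randers_vectors ::
    "'a monoid \<Rightarrow> 'a mfd \<Rightarrow> 'a set \<Rightarrow> ('a tvec \<Rightarrow> 'a tvec \<Rightarrow> real) \<Rightarrow> 'a tvec set" where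
  "randers_vectors G M H ip =
     {X \<in> orth_complement G M H ip. (\<forall>h\<in>H. Ad G M h X = X) \<and> ip X X < 1}"

text \<open>The invariant vector field on \<open>G/H\<close> with value \<open>d\<pi>(X)\<close> at \<open>H\<close>; the value at a coset does not
  depend on the representative when \<open>X\<close> is fixed by the adjoint action of \<open>H\<close>.\<close>

definition invariant_field :: "'a monoid \<Rightarrow> 'a set \<Rightarrow> 'a set mfd \<Rightarrow> 'a tvec \<Rightarrow> 'a set \<Rightarrow> 'a set tvec"
  where "invariant_field G H Q X \<xi> =
    differential Q (translation G (SOME a. a \<in> \<xi>)) (tangent_proj G H Q X)"

definition randers_metric ::
    "'a monoid \<Rightarrow> 'a set \<Rightarrow> 'a set mfd \<Rightarrow> ('a set \<Rightarrow> 'a set tvec \<Rightarrow> 'a set tvec \<Rightarrow> real) \<Rightarrow>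
     'a tvec \<Rightarrow> 'a set \<Rightarrow> 'a set tvec \<Rightarrow> real" where
  "randers_metric G H Q g X \<xi> y = sqrt (g \<xi> y y) + g \<xi> (invariant_field G H Q X \<xi>) y"

end

theory Submission
  imports Defs
begin

text \<open>
  The assertion fails for its second equation, and already for the trivial subgroup \<open>H = {e}\<close>. Then
  \<open>\<hh> = 0\<close>, the complement \<open>\<mm>\<close> is the whole Lie algebra, and \<open>[Y, U]\<^sub>\<hh> = 0\<close>; so the formula would make
  every left invariant Riemannian metric on every connected Lie group flat. (The expression
  \<open>\<langle>[[Y, U]\<^sub>\<hh>, Y], U\<rangle>\<close> is the curvature of a symmetric space, where \<open>[\<mm>, \<mm>] \<subseteq> \<hh>\<close>; for a general reductive
  space terms with \<open>[Y, U]\<^sub>\<mm>\<close> are missing.) The counterexample is the group of orientation preserving affine maps of the line, with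
  multiplication \<open>(s, t) (s', t') = (s + e\<^sup>t s', t + t')\<close> and the left invariant metric \<open>e\<^sup>-\<^sup>2\<^sup>t ds\<^sup>2 + dt\<^sup>2\<close>,
  that is, the hyperbolic plane. Its curvature is \<open>-1\<close> (lemma \<open>sectional_curvature_hyp\<close>), whereas the
  formula gives \<open>0\<close>. The Randers vector \<open>X = 0\<close> is admissible, and no flag curvature has to be computed.

  Most of the work is to show that these data satisfy the definitions (lemma
  \<open>reductive_riemannian_hyp\<close>). Tangent vectors are arbitrary point derivations of smooth functions, and an
  inner product must be positive on all of them; so every derivation has to be a combination of partial
  derivatives (\<open>tangent_expansion\<close>). This follows from Hadamard's lemma (\<open>hadamard_coordinate\<close>), whose
  smooth remainder is an integral over a segment (\<open>Ck_segment_avg\<close>). The projection to \<open>\<hh>\<close> is determined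
  only on the Lie algebra, hence the bracket must be shown to be a derivation again
  (\<open>lie_bracket_tangent\<close>).
\<close>

section \<open>Smooth functions on coordinate space\<close>

abbreviation cspace :: "nat \<Rightarrow> coord set"
  where "cspace n \<equiv> topspace (Euclidean_space n)"

lemma cspace_iff: "x \<in> cspace n \<longleftrightarrow> (\<forall>i\<ge>n. x i = 0)"
  by (simp add: topspace_Euclidean_space)

lemma cspace_upd: "x \<in> cspace n \<Longrightarrow> i < n \<Longrightarrow> x(i := t) \<in> cspace n"
  by (simp add: cspace_iff)

lemma Euclidean_space_eq_top_of_set: "Euclidean_space n = top_of_set {x. \<forall>i\<ge>n. x i = 0}"
  by (simp only: Euclidean_space_def euclidean_product_topology)

lemma continuous_map_cspace:
  "continuous_map (subtopology (Euclidean_space n) (cspace n)) euclideanreal f \<longleftrightarrow>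
    continuous_on (cspace n) f"
  unfolding subtopology_topspace unfolding Euclidean_space_eq_top_of_set by simp

lemma Ck_0_iff: "Ck_on n 0 (cspace n) f \<longleftrightarrow> continuous_on (cspace n) f"
  unfolding Ck_on.simps continuous_map_cspace ..

lemma Ck_Suc_iff:
  "Ck_on n (Suc k) (cspace n) f \<longleftrightarrow> continuous_on (cspace n) f \<and>
    (\<forall>i<n. (\<forall>x\<in>cspace n. (\<lambda>t. f (x(i := t))) field_differentiable at (x i)) \<and>
      Ck_on n k (cspace n) (pd i f))"
  unfolding Ck_on.simps continuous_map_cspace ..

text \<open>The equations of \<^const>\<open>Ck_on\<close> speak of the subspace topology; with them removed from the
  simplifier, all arguments go through \<^const>\<open>continuous_on\<close> for the product topology on sequences.\<close>

declare Ck_on.simps [simp del]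

lemma Ck_continuous_on: "Ck_on n k (cspace n) f \<Longrightarrow> continuous_on (cspace n) f"
  by (cases k) (blast dest: Ck_0_iff[THEN iffD1] Ck_Suc_iff[THEN iffD1])+

lemma pd_eqI:
  "((\<lambda>t. f (x(i := t))) has_real_derivative D) (at (x i)) \<Longrightarrow> pd i f x = D"
  unfolding pd_def by (rule DERIV_imp_deriv)

lemma Ck_SucD:
  assumes "Ck_on n (Suc k) (cspace n) f" "i < n"
  shows "Ck_on n k (cspace n) (pd i f)"
    and "x \<in> cspace n \<Longrightarrow>
      ((\<lambda>t. f (x(i := t))) has_real_derivative pd i f (x(i := s))) (at s)"
proof -
  show "Ck_on n k (cspace n) (pd i f)"
    using assms Ck_Suc_iff by blast
  show "((\<lambda>t. f (x(i := t))) has_real_derivative pd i f (x(i := s))) (at s)" if "x \<in> cspace n"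
  proof -
    have "(\<lambda>t. f ((x(i := s))(i := t))) field_differentiable at ((x(i := s)) i)"
      using assms cspace_upd[OF that \<open>i < n\<close>] by (metis Ck_Suc_iff)
    then show ?thesis
      by (simp add: pd_def field_differentiable_derivI)
  qed
qed

lemma Ck_has_pd:
  assumes "Ck_on n (Suc k) (cspace n) f" "i < n" "x \<in> cspace n"
  shows "((\<lambda>t. f (x(i := t))) has_real_derivative pd i f x) (at (x i))"
  using Ck_SucD(2)[OF assms, of "x i"] by (simp only: fun_upd_triv)

lemma pd_cong:
  assumes "\<And>x. x \<in> cspace n \<Longrightarrow> f x = g x" "i < n" "x \<in> cspace n"
  shows "pd i f x = pd i g x"
proof -
  have "(\<lambda>t. f (x(i := t))) = (\<lambda>t. g (x(i := t)))"
    using assms cspace_upd by blast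
  then show ?thesis
    by (simp add: pd_def)
qed

lemma Ck_cong:
  assumes "\<And>x. x \<in> cspace n \<Longrightarrow> f x = g x"
  shows "Ck_on n k (cspace n) f \<longleftrightarrow> Ck_on n k (cspace n) g"
  using assms
proof (induction k arbitrary: f g)
  case 0
  then show ?case
    unfolding Ck_0_iff using continuous_on_cong by blast
next
  case (Suc k)
  have "(\<lambda>t. f (x(i := t))) = (\<lambda>t. g (x(i := t)))" if "i < n" "x \<in> cspace n" for i x
    using Suc.prems cspace_upd[OF that(2,1)] by blast
  moreover have "Ck_on n k (cspace n) (pd i f) = Ck_on n k (cspace n) (pd i g)" if "i < n" for i
    using pd_cong[OF Suc.prems that] by (rule Suc.IH)
  moreover have "continuous_on (cspace n) f \<longleftrightarrow> continuous_on (cspace n) g"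
    using continuous_on_cong Suc.prems by blast
  ultimately show ?case
    unfolding Ck_Suc_iff by metis
qed

text \<open>Partial derivatives only have to be found on the coordinate space, since moving a coordinate
  below \<open>n\<close> does not leave it. This is the induction step of every regularity proof below.\<close>

lemma Ck_SucI:
  assumes "continuous_on (cspace n) f"
    and deriv: "\<And>i x. i < n \<Longrightarrow> x \<in> cspace n \<Longrightarrow>
      ((\<lambda>t. f (x(i := t))) has_real_derivative g i x) (at (x i))"
    and "\<And>i. i < n \<Longrightarrow> Ck_on n k (cspace n) (g i)"
  shows "Ck_on n (Suc k) (cspace n) f"
proof -
  have "Ck_on n k (cspace n) (pd i f)" if "i < n" for i
    using Ck_cong[where f = "pd i f" and g = "g i" and n = n and k = k, OF pd_eqI[OF deriv[OF that]]]
      assms(3)[OF that] by blast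
  then show ?thesis
    using assms(1) deriv unfolding Ck_Suc_iff field_differentiable_def by blast
qed

lemma Ck_0I: "continuous_on (cspace n) f \<Longrightarrow> Ck_on n 0 (cspace n) f"
  by (simp only: Ck_0_iff)

lemma Ck_Suc_imp: "Ck_on n (Suc k) (cspace n) f \<Longrightarrow> Ck_on n k (cspace n) f"
proof (induction k arbitrary: f)
  case 0
  show ?case by (rule Ck_0I[OF Ck_continuous_on[OF 0]])
next
  case (Suc k)
  show ?case
  proof (rule Ck_SucI)
    show "continuous_on (cspace n) f"
      using Suc.prems by (rule Ck_continuous_on)
    show "((\<lambda>t. f (x(i := t))) has_real_derivative pd i f x) (at (x i))"
      if "i < n" "x \<in> cspace n" for i x
      using Suc.prems that by (rule Ck_has_pd)
    show "Ck_on n k (cspace n) (pd i f)" if "i < n" for i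
      using Suc.IH[OF Ck_SucD(1)[OF Suc.prems that]] .
  qed
qed

lemma smooth_on_cong:
  "(\<And>x. x \<in> cspace n \<Longrightarrow> f x = g x) \<Longrightarrow>
    smooth_on n (cspace n) f \<longleftrightarrow> smooth_on n (cspace n) g"
  unfolding smooth_on_def using Ck_cong by blast

lemma smooth_pd: "smooth_on n (cspace n) f \<Longrightarrow> i < n \<Longrightarrow> smooth_on n (cspace n) (pd i f)"
  unfolding smooth_on_def using Ck_SucD(1) by blast

lemma smooth_has_pd:
  assumes "smooth_on n (cspace n) f" "i < n" "x \<in> cspace n"
  shows "((\<lambda>t. f (x(i := t))) has_real_derivative pd i f (x(i := s))) (at s)"
  using assms Ck_SucD(2)[of n 0 f i x s] unfolding smooth_on_def by blast

lemma smooth_has_pd_at: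
  assumes "smooth_on n (cspace n) f" "i < n" "x \<in> cspace n"
  shows "((\<lambda>t. f (x(i := t))) has_real_derivative pd i f x) (at (x i))"
  using smooth_has_pd[OF assms, of "x i"] by (simp only: fun_upd_triv)

lemma Ck_const: "Ck_on n k (cspace n) (\<lambda>x. c)"
proof (induction k arbitrary: c)
  case 0
  then show ?case by (simp add: Ck_0I)
next
  case (Suc k)
  show ?case
    by (rule Ck_SucI[where g = "\<lambda>_ _. 0"]) (auto intro: Suc.IH)
qed

lemma smooth_const: "smooth_on n (cspace n) (\<lambda>x. c)"
  unfolding smooth_on_def by (simp add: Ck_const)

lemma continuous_on_coord: "continuous_on S (\<lambda>x::coord. x j)"
  by (rule continuous_on_product_then_coordinatewise[OF continuous_on_id])

lemma smooth_coord: "smooth_on n (cspace n) (\<lambda>x. x j)"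
proof -
  have "Ck_on n k (cspace n) (\<lambda>x. x j)" for k
  proof (cases k)
    case 0
    show ?thesis unfolding 0 by (intro Ck_0I continuous_on_coord)
  next
    case (Suc k')
    show ?thesis unfolding Suc
      by (rule Ck_SucI[where g = "\<lambda>i _. if i = j then 1 else 0"])
        (auto intro: Ck_const continuous_on_coord)
  qed
  then show ?thesis by (simp add: smooth_on_def)
qed

lemma Ck_add:
  "Ck_on n k (cspace n) f \<Longrightarrow> Ck_on n k (cspace n) g \<Longrightarrow> Ck_on n k (cspace n) (\<lambda>x. f x + g x)"
proof (induction k arbitrary: f g)
  case 0
  then show ?case unfolding Ck_0_iff by (rule continuous_on_add)
next
  case (Suc k)
  show ?case
  proof (rule Ck_SucI[where g = "\<lambda>i x. pd i f x + pd i g x"])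
    show "((\<lambda>t. f (x(i := t)) + g (x(i := t))) has_real_derivative pd i f x + pd i g x) (at (x i))"
      if "i < n" "x \<in> cspace n" for i x
      using DERIV_add[OF Ck_has_pd[OF Suc.prems(1) that] Ck_has_pd[OF Suc.prems(2) that]] .
      show "Ck_on n k (cspace n) (\<lambda>x. pd i f x + pd i g x)" if "i < n" for i
      by (intro Suc.IH Ck_SucD(1)[OF _ that] Suc.prems)
    show "continuous_on (cspace n) (\<lambda>x. f x + g x)"
      by (intro continuous_on_add Ck_continuous_on[OF Suc.prems(1)] Ck_continuous_on[OF Suc.prems(2)])
  qed
qed

lemma smooth_add:
  "smooth_on n (cspace n) f \<Longrightarrow> smooth_on n (cspace n) g \<Longrightarrow> smooth_on n (cspace n) (\<lambda>x. f x + g x)"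
  by (simp add: smooth_on_def Ck_add)

lemma Ck_mult:
  "Ck_on n k (cspace n) f \<Longrightarrow> Ck_on n k (cspace n) g \<Longrightarrow> Ck_on n k (cspace n) (\<lambda>x. f x * g x)"
proof (induction k arbitrary: f g)
  case 0
  then show ?case unfolding Ck_0_iff by (rule continuous_on_mult)
next
  case (Suc k)
  show ?case
  proof (rule Ck_SucI[where g = "\<lambda>i x. pd i f x * g x + pd i g x * f x"])
    show "((\<lambda>t. f (x(i := t)) * g (x(i := t))) has_real_derivative
        pd i f x * g x + pd i g x * f x) (at (x i))"
      if "i < n" "x \<in> cspace n" for i x
      using DERIV_mult[OF Ck_has_pd[OF Suc.prems(1) that] Ck_has_pd[OF Suc.prems(2) that]]
      by (simp only: fun_upd_triv)
    show "Ck_on n k (cspace n) (\<lambda>x. pd i f x * g x + pd i g x * f x)" if "i < n" for i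
      using Suc.IH Ck_add Ck_SucD(1)[OF Suc.prems(1) that] Ck_SucD(1)[OF Suc.prems(2) that]
        Ck_Suc_imp[OF Suc.prems(1)] Ck_Suc_imp[OF Suc.prems(2)] by blast
    show "continuous_on (cspace n) (\<lambda>x. f x * g x)"
      by (intro continuous_on_mult Ck_continuous_on[OF Suc.prems(1)] Ck_continuous_on[OF Suc.prems(2)])
  qed
qed

lemma smooth_mult:
  "smooth_on n (cspace n) f \<Longrightarrow> smooth_on n (cspace n) g \<Longrightarrow> smooth_on n (cspace n) (\<lambda>x. f x * g x)"
  by (simp add: smooth_on_def Ck_mult)

lemma Ck_exp: "Ck_on n k (cspace n) f \<Longrightarrow> Ck_on n k (cspace n) (\<lambda>x. exp (f x))"
proof (induction k)
  case 0
  then show ?case unfolding Ck_0_iff by (rule continuous_on_exp)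
next
  case (Suc k)
  show ?case
  proof (rule Ck_SucI[where g = "\<lambda>i x. exp (f x) * pd i f x"])
    show "((\<lambda>t. exp (f (x(i := t)))) has_real_derivative exp (f x) * pd i f x) (at (x i))"
      if "i < n" "x \<in> cspace n" for i x
      using DERIV_fun_exp[OF Ck_has_pd[OF Suc.prems that]] by (simp only: fun_upd_triv)
    show "Ck_on n k (cspace n) (\<lambda>x. exp (f x) * pd i f x)" if "i < n" for i
      by (rule Ck_mult[OF Suc.IH[OF Ck_Suc_imp[OF Suc.prems]] Ck_SucD(1)[OF Suc.prems that]])
    show "continuous_on (cspace n) (\<lambda>x. exp (f x))"
      by (intro continuous_on_exp Ck_continuous_on[OF Suc.prems])
  qed
qed

lemma smooth_exp: "smooth_on n (cspace n) f \<Longrightarrow> smooth_on n (cspace n) (\<lambda>x. exp (f x))"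
  by (simp add: smooth_on_def Ck_exp)

lemma pd_add:
  assumes "smooth_on n (cspace n) f" "smooth_on n (cspace n) g" "i < n" "x \<in> cspace n"
  shows "pd i (\<lambda>x. f x + g x) x = pd i f x + pd i g x"
  by (rule pd_eqI[OF DERIV_add[OF smooth_has_pd_at[OF assms(1,3,4)] smooth_has_pd_at[OF assms(2,3,4)]]])

lemma pd_mult:
  assumes "smooth_on n (cspace n) f" "smooth_on n (cspace n) g" "i < n" "x \<in> cspace n"
  shows "pd i (\<lambda>x. f x * g x) x = f x * pd i g x + g x * pd i f x"
  using pd_eqI[OF DERIV_mult[OF smooth_has_pd_at[OF assms(1,3,4)] smooth_has_pd_at[OF assms(2,3,4)]]]
  by (simp only: fun_upd_triv mult.commute add.commute)

lemma pd_coord: "pd i (\<lambda>x. x j) x = (if i = j then 1 else 0)"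
  by (rule pd_eqI) auto

lemma pd_const: "pd i (\<lambda>x. c) x = 0"
  by (rule pd_eqI) auto

lemma affine_continuous_on: "continuous_on S (\<lambda>x::coord. \<lambda>j. a j + b j * x j)"
  by (intro continuous_on_coordinatewise_then_product continuous_intros continuous_on_coord)

text \<open>The maps used below (left translations, freezing of coordinates) act on each coordinate by a
  separate affine function, so that a partial derivative of the composition involves just one partial
  derivative of \<open>f\<close>.\<close>

lemma affine_has_derivative:
  assumes f: "\<And>y s. y \<in> cspace n \<Longrightarrow>
      ((\<lambda>t. f (y(i := t))) has_real_derivative f' (y(i := s))) (at s)"
    and y: "(\<lambda>j. a j + b j * x j) \<in> cspace n"
  shows "((\<lambda>t. f (\<lambda>j. a j + b j * (x(i := t)) j)) has_real_derivative
      b i * f' (\<lambda>j. a j + b j * (x(i := s)) j)) (at s)"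
proof -
  define y where "y = (\<lambda>j. a j + b j * x j)"
  have eq: "(\<lambda>j. a j + b j * (x(i := t)) j) = y(i := a i + b i * t)" for t
    by (auto simp: y_def)
  have "((\<lambda>t. a i + b i * t) has_real_derivative b i) (at s)"
    by (auto intro!: derivative_eq_intros)
  from DERIV_cong[OF DERIV_chain2[OF f[OF y[folded y_def]] this] mult.commute]
  show ?thesis
    by (simp only: eq)
qed

lemma Ck_affine:
  assumes "\<And>x. x \<in> cspace n \<Longrightarrow> (\<lambda>j. a j + b j * x j) \<in> cspace n"
  shows "Ck_on n k (cspace n) f \<Longrightarrow> Ck_on n k (cspace n) (\<lambda>x. f (\<lambda>j. a j + b j * x j))"
proof (induction k arbitrary: f)
  case 0
  show ?case
    by (rule Ck_0I, rule continuous_on_compose2[OF Ck_continuous_on[OF 0] affine_continuous_on])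
      (use assms in auto)
next
  case (Suc k)
  show ?case
  proof (rule Ck_SucI[where g = "\<lambda>i x. b i * pd i f (\<lambda>j. a j + b j * x j)"])
    show "continuous_on (cspace n) (\<lambda>x. f (\<lambda>j. a j + b j * x j))"
      by (rule continuous_on_compose2[OF Ck_continuous_on[OF Suc.prems] affine_continuous_on])
        (use assms in auto)
    show "((\<lambda>t. f (\<lambda>j. a j + b j * (x(i := t)) j)) has_real_derivative
        b i * pd i f (\<lambda>j. a j + b j * x j)) (at (x i))" if "i < n" "x \<in> cspace n" for i x
      using affine_has_derivative[where f = f and f' = "pd i f" and s = "x i" and x = x and i = i,
          OF Ck_SucD(2)[OF Suc.prems that(1)] assms[OF that(2)]] by simp
    show "Ck_on n k (cspace n) (\<lambda>x. b i * pd i f (\<lambda>j. a j + b j * x j))" if "i < n" for i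
      by (intro Ck_mult Ck_const Suc.IH Ck_SucD(1)[OF Suc.prems that])
  qed
qed

lemma smooth_affine:
  assumes "\<And>x. x \<in> cspace n \<Longrightarrow> (\<lambda>j. a j + b j * x j) \<in> cspace n"
    and "smooth_on n (cspace n) f"
  shows "smooth_on n (cspace n) (\<lambda>x. f (\<lambda>j. a j + b j * x j))"
  using assms Ck_affine unfolding smooth_on_def by blast

lemma pd_affine:
  assumes "\<And>x. x \<in> cspace n \<Longrightarrow> (\<lambda>j. a j + b j * x j) \<in> cspace n"
    and "smooth_on n (cspace n) f" "i < n" "x \<in> cspace n"
  shows "pd i (\<lambda>x. f (\<lambda>j. a j + b j * x j)) x = b i * pd i f (\<lambda>j. a j + b j * x j)"
  using affine_has_derivative[where f = f and f' = "pd i f" and s = "x i" and x = x and i = i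
      and n = n and a = a and b = b, OF smooth_has_pd[OF assms(2,3)] assms(1)[OF assms(4)]]
  by (intro pd_eqI) (simp only: fun_upd_triv)

section \<open>Hadamard's lemma\<close>

text \<open>The integral remainder of the Taylor formula in the \<open>i\<close>-th coordinate, centred at \<open>c\<close>. The weight
  \<open>r ^ m\<close> makes the class of these functions closed under differentiation: each derivative in
  direction \<open>i\<close> produces another factor \<open>r\<close>.\<close>

definition segment_avg :: "nat \<Rightarrow> real \<Rightarrow> nat \<Rightarrow> (coord \<Rightarrow> real) \<Rightarrow> coord \<Rightarrow> real" where
  "segment_avg i c m h x = integral (cbox 0 1) (\<lambda>r. r ^ m * h (x(i := c + r * (x i - c))))"

lemma continuous_on_segment_integrand:
  assumes "continuous_on (cspace n) h" "i < n"
  shows "continuous_on (cspace n \<times> T) (\<lambda>(x, r). r ^ m * h (x(i := c + r * (x i - c))))"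
proof -
  have *: "continuous_on (cspace n \<times> T) (\<lambda>z. (fst z) (i := c + snd z * (fst z i - c)))"
  proof (rule continuous_on_coordinatewise_then_product)
    fix j
    have "continuous_on (cspace n \<times> T) (\<lambda>z. fst z l)" for l
      by (rule continuous_on_compose2[OF continuous_on_coord continuous_on_fst[OF continuous_on_id] subset_UNIV])
    then show "continuous_on (cspace n \<times> T) (\<lambda>z. ((fst z) (i := c + snd z * (fst z i - c))) j)"
      by (cases "j = i") (auto intro!: continuous_intros)
  qed
  have "continuous_on (cspace n \<times> T) (\<lambda>z. h ((fst z) (i := c + snd z * (fst z i - c))))"
    by (rule continuous_on_compose2[OF assms(1) *]) (use cspace_upd[OF _ assms(2)] in auto)
  then show ?thesis
    unfolding split_beta by (intro continuous_intros)
qed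

text \<open>Differentiation under the integral sign. The segment moves one coordinate only, so the chain
  rule needed here is the one-variable one.\<close>

lemma Ck_segment_avg:
  assumes "i < n"
  shows "Ck_on n k (cspace n) h \<Longrightarrow> Ck_on n k (cspace n) (segment_avg i c m h)"
proof (induction k arbitrary: h m)
  case 0
  show ?case
    unfolding segment_avg_def
    by (intro Ck_0I integral_continuous_on_param continuous_on_segment_integrand
        Ck_continuous_on[OF 0] assms)
next
  case (Suc k)
  show ?case
  proof (rule Ck_SucI[where g = "\<lambda>j. segment_avg i c (if j = i then Suc m else m) (pd j h)"])
    show "continuous_on (cspace n) (segment_avg i c m h)"
      unfolding segment_avg_def
      by (intro integral_continuous_on_param continuous_on_segment_integrand
        Ck_continuous_on[OF Suc.prems] assms)
    show "Ck_on n k (cspace n) (segment_avg i c (if j = i then Suc m else m) (pd j h))"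
      if "j < n" for j
      by (rule Suc.IH[OF Ck_SucD(1)[OF Suc.prems that]])
    fix j x
    assume j: "j < n" and x: "x \<in> cspace n"
    define m' where "m' = (if j = i then Suc m else m)"
    define p where "p r y = y(i := c + r * (y i - c))" for r and y :: coord
    have p_mem: "p r y \<in> cspace n" if "y \<in> cspace n" for r y
      using that assms by (simp add: p_def cspace_upd)
    have line: "continuous_on UNIV (\<lambda>s. x(j := s))"
    proof (rule continuous_on_coordinatewise_then_product)
      show "continuous_on UNIV (\<lambda>s. (x(j := s)) l)" for l
        by (cases "l = j") (auto intro!: continuous_intros)
    qed
    have cont: "continuous_on (UNIV \<times> cbox 0 1) (\<lambda>(s, r). r ^ q * u (p r (x(j := s))))"
      if "continuous_on (cspace n) u" for q u
    proof -
      have 1: "continuous_on (UNIV \<times> cbox 0 1) (\<lambda>z::real \<times> real. (x(j := fst z), snd z))"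
        by (intro continuous_on_Pair continuous_on_compose2[OF line continuous_on_fst[OF continuous_on_id]]
            continuous_on_snd continuous_on_id) auto
      show ?thesis
        using continuous_on_compose2[OF continuous_on_segment_integrand[OF that assms, of UNIV q c] 1]
          cspace_upd[OF x j] by (auto simp: split_beta p_def)
    qed
    have "((\<lambda>s. integral (cbox 0 1) (\<lambda>r. r ^ m * h (p r (x(j := s)))))
        has_field_derivative integral (cbox 0 1) (\<lambda>r. r ^ m' * pd j h (p r (x(j := x j)))))
        (at (x j) within UNIV)"
    proof (rule leibniz_rule_field_derivative[where U = UNIV and
            f = "\<lambda>s r. r ^ m * h (p r (x(j := s)))" and fx = "\<lambda>s r. r ^ m' * pd j h (p r (x(j := s)))"])
      fix s r :: real
      define b where "b = (\<lambda>l. if l = i then r else 1)"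
      define a where "a = (\<lambda>l. if l = i then c - r * c else 0)"
      have p_eq: "p r y = (\<lambda>l. a l + b l * y l)" for y
        by (auto simp: p_def a_def b_def algebra_simps)
      have y: "(\<lambda>l. a l + b l * x l) \<in> cspace n"
        using p_mem[OF x, of r] unfolding p_eq .
      have "((\<lambda>t. h (p r (x(j := t)))) has_real_derivative b j * pd j h (p r (x(j := s)))) (at s)"
        unfolding p_eq
        by (rule affine_has_derivative[where f = h and f' = "pd j h" and i = j and n = n, OF _ y])
          (rule Ck_SucD(2)[OF Suc.prems j])
      moreover have "r ^ m * (b j * z) = r ^ m' * z" for z
        by (simp add: m'_def b_def)
      ultimately show "((\<lambda>s. r ^ m * h (p r (x(j := s)))) has_real_derivative
          r ^ m' * pd j h (p r (x(j := s)))) (at s within UNIV)"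
        using DERIV_cmult[of "\<lambda>s. h (p r (x(j := s)))" _ s UNIV "r ^ m"] by metis
    next
      fix s :: real
      have "continuous_on (cbox 0 1) (\<lambda>r. r ^ m * h (p r (x(j := s))))"
        using continuous_on_compose2[OF cont[OF Ck_continuous_on[OF Suc.prems], of m]
            continuous_on_Pair[OF continuous_on_const[where c = s] continuous_on_id[of "cbox 0 1"]]]
        by (simp add: image_subset_iff)
      then show "(\<lambda>r. r ^ m * h (p r (x(j := s)))) integrable_on cbox 0 1"
        by (rule integrable_continuous)
    next
      show "continuous_on (UNIV \<times> cbox 0 1) (\<lambda>(s, r). r ^ m' * pd j h (p r (x(j := s))))"
        by (rule cont[OF Ck_continuous_on[OF Ck_SucD(1)[OF Suc.prems j]]])
    qed auto
    then show "((\<lambda>t. segment_avg i c m h (x(j := t))) has_real_derivative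
        segment_avg i c (if j = i then Suc m else m) (pd j h) x) (at (x j))"
      by (simp add: segment_avg_def p_def m'_def)
  qed
qed

text \<open>Hadamard's lemma in a single coordinate: the fundamental theorem of calculus along the segment
  that moves the \<open>i\<close>-th coordinate from \<open>c\<close> to \<open>x i\<close>.\<close>

lemma hadamard_coordinate:
  assumes f: "smooth_on n (cspace n) f" and i: "i < n"
  obtains h where "smooth_on n (cspace n) h"
    and "\<And>x. x \<in> cspace n \<Longrightarrow> f x - f (x(i := c)) = (x i - c) * h x"
    and "\<And>x. x i = c \<Longrightarrow> h x = pd i f x"
proof
  let ?h = "segment_avg i c 0 (pd i f)"
  show "smooth_on n (cspace n) ?h"
    using smooth_pd[OF f i] Ck_segment_avg[OF i] unfolding smooth_on_def by blast
  show "?h x = pd i f x" if "x i = c" for x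
    using that by (auto simp: segment_avg_def fun_upd_idem)
  show "f x - f (x(i := c)) = (x i - c) * ?h x" if x: "x \<in> cspace n" for x
  proof -
    have "((\<lambda>r. (x i - c) * pd i f (x(i := c + r * (x i - c)))) has_integral
        f (x(i := c + 1 * (x i - c))) - f (x(i := c + 0 * (x i - c)))) {0..1}"
    proof (rule fundamental_theorem_of_calculus)
      fix r :: real
      have "((\<lambda>r. c + r * (x i - c)) has_real_derivative x i - c) (at r)"
        by (auto intro!: derivative_eq_intros)
      from DERIV_chain2[OF smooth_has_pd[OF f i x] this]
      show "((\<lambda>r. f (x(i := c + r * (x i - c)))) has_vector_derivative
          (x i - c) * pd i f (x(i := c + r * (x i - c)))) (at r within {0..1})"
        by (simp add: has_real_derivative_iff_has_vector_derivative[symmetric] mult.commute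
            has_field_derivative_at_within)
    qed auto
    moreover have "c + 1 * (x i - c) = x i" "c + 0 * (x i - c) = c"
      by simp_all
    ultimately have "integral {0..1} (\<lambda>r. (x i - c) * pd i f (x(i := c + r * (x i - c)))) =
        f x - f (x(i := c))"
      by (simp only: fun_upd_triv integral_unique)
    then show ?thesis
      by (simp add: segment_avg_def)
  qed
qed

section \<open>Manifolds with a global chart\<close>

lemma second_countable_euclidean:
  "second_countable (euclidean :: 'a::second_countable_topology topology)"
proof -
  obtain \<B> :: "'a set set" where "countable \<B>" "topological_basis \<B>"
    using ex_countable_basis by blast
  then show ?thesis
    unfolding second_countable_def open_openin[symmetric]
    by (metis topological_basisE topological_basis_open)
qed

lemma second_countable_Euclidean_space: "second_countable (Euclidean_space n)"
  unfolding Euclidean_space_def euclidean_product_topology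
  by (rule second_countable_subtopology[OF second_countable_euclidean])

lemma sum_fun_apply: "(\<Sum>i\<in>A. f i) z = (\<Sum>i\<in>A. f i z)"
  by (induction A rule: infinite_finite_induct) auto

text \<open>A manifold whose atlas is a single chart onto the whole coordinate space. Both the group and its
  coset space are of this kind, with different point types.\<close>

locale global_chart =
  fixes N :: "'a mfd" and \<phi> :: "'a \<Rightarrow> coord"
  assumes atlas: "atlas N = {(topspace (mtop N), \<phi>)}"
    and chart: "homeomorphic_map (mtop N) (Euclidean_space (mdim N)) \<phi>"
begin

abbreviation S where "S \<equiv> topspace (mtop N)"
abbreviation n where "n \<equiv> mdim N"
abbreviation \<phi>i where "\<phi>i \<equiv> inv_into S \<phi>"

lemma chart_image: "\<phi> ` S = cspace n"
  and chart_inj: "inj_on \<phi> S"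
  using chart by (auto simp: homeomorphic_eq_everything_map)

lemma chart_mem: "p \<in> S \<Longrightarrow> \<phi> p \<in> cspace n"
  using chart_image by blast

lemma chart_inv_mem: "x \<in> cspace n \<Longrightarrow> \<phi>i x \<in> S"
  using chart_image by (metis inv_into_into)

lemma chart_inv_right: "x \<in> cspace n \<Longrightarrow> \<phi> (\<phi>i x) = x"
  using chart_image by (metis f_inv_into_f)

lemma chart_inv_left: "p \<in> S \<Longrightarrow> \<phi>i (\<phi> p) = p"
  using chart_inj by simp

lemma smooth_manifold: "smooth_manifold N"
proof -
  have hom: "mtop N homeomorphic_space Euclidean_space n"
    using chart homeomorphic_map_imp_homeomorphic_space by blast
  have "second_countable (mtop N)"
    using homeomorphic_space_second_countability[OF hom] second_countable_Euclidean_space by blast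
  moreover have "Hausdorff_space (mtop N)"
    using homeomorphic_Hausdorff_space[OF hom] Hausdorff_Euclidean_space by blast
  moreover have "smooth_on n (cspace n) (\<lambda>x. \<phi> (\<phi>i x) i)" for i
    using smooth_on_cong[of n "\<lambda>x. \<phi> (\<phi>i x) i" "\<lambda>x. x i"] smooth_coord chart_inv_right by metis
  ultimately show ?thesis
    using chart unfolding smooth_manifold_def second_countable_def atlas by (simp add: chart_image)
qed

lemma Cinf_iff: "f \<in> Cinf N \<longleftrightarrow> smooth_on n (cspace n) (\<lambda>x. f (\<phi>i x))"
  by (simp add: Cinf_def atlas chart_image)

lemma Cinf_cong: "(\<And>q. q \<in> S \<Longrightarrow> f q = h q) \<Longrightarrow> f \<in> Cinf N \<longleftrightarrow> h \<in> Cinf N"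
  unfolding Cinf_iff using chart_inv_mem by (intro smooth_on_cong) blast

lemma Cinf_chart: "smooth_on n (cspace n) F \<Longrightarrow> (\<lambda>q. F (\<phi> q)) \<in> Cinf N"
  unfolding Cinf_iff
  using smooth_on_cong[of n "\<lambda>x. F (\<phi> (\<phi>i x))" F] chart_inv_right by simp

lemma Cinf_coord: "(\<lambda>q. \<phi> q j) \<in> Cinf N"
  using Cinf_chart[OF smooth_coord] .

lemma Cinf_const: "(\<lambda>q. c) \<in> Cinf N"
  by (simp add: Cinf_iff smooth_const)

lemma Cinf_mult: "f \<in> Cinf N \<Longrightarrow> h \<in> Cinf N \<Longrightarrow> (\<lambda>q. f q * h q) \<in> Cinf N"
  unfolding Cinf_iff by (rule smooth_mult)

lemma Cinf_lincomb: "f \<in> Cinf N \<Longrightarrow> h \<in> Cinf N \<Longrightarrow> (\<lambda>q. a * f q + b * h q) \<in> Cinf N"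
  unfolding Cinf_iff by (intro smooth_add smooth_mult smooth_const)

lemma tangent_outside: "v \<in> tangent N p \<Longrightarrow> f \<notin> Cinf N \<Longrightarrow> v f = 0"
  and tangent_lincomb: "v \<in> tangent N p \<Longrightarrow> f \<in> Cinf N \<Longrightarrow> h \<in> Cinf N \<Longrightarrow>
    v (\<lambda>q. a * f q + b * h q) = a * v f + b * v h"
  and tangent_mult: "v \<in> tangent N p \<Longrightarrow> f \<in> Cinf N \<Longrightarrow> h \<in> Cinf N \<Longrightarrow>
    v (\<lambda>q. f q * h q) = f p * v h + h p * v f"
  by (auto simp: tangent_def)

lemma tangent_const:
  assumes "v \<in> tangent N p"
  shows "v (\<lambda>q. c) = 0"
proof -
  have "v (\<lambda>q. 1) = 0"
    using tangent_mult[OF assms Cinf_const Cinf_const, of 1 1] by simp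
  then show ?thesis
    using tangent_lincomb[OF assms Cinf_const[of 1] Cinf_const[of 1], of c 0] by simp
qed

text \<open>Membership in \<^const>\<open>Cinf\<close> does not restrict a function outside the manifold, so it has to be shown
  that tangent vectors ignore the values there. The indicator of the complement is a smooth function
  that vanishes on the manifold; multiplying by it and using the product rule gives the claim.\<close>

lemma tangent_local:
  assumes v: "v \<in> tangent N p" and p: "p \<in> S" and eq: "\<And>q. q \<in> S \<Longrightarrow> f q = h q"
  shows "v f = v h"
proof (cases "f \<in> Cinf N")
  case False
  then have "h \<notin> Cinf N"
    using Cinf_cong[of f h] eq by blast
  then show ?thesis
    using False tangent_outside[OF v] by simp
next
  case True
  then have h: "h \<in> Cinf N"
    using Cinf_cong[of f h] eq by blast
  define d where "d = (\<lambda>q. 1 * f q + (- 1) * h q)"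
  define ind where "ind = (\<lambda>q. if q \<in> S then 0 else (1::real))"
  have d: "d \<in> Cinf N"
    unfolding d_def by (rule Cinf_lincomb[OF True h])
  have ind: "ind \<in> Cinf N"
    using Cinf_cong[of ind "\<lambda>_. 0"] Cinf_const[of 0] unfolding ind_def by simp
  have "d = (\<lambda>q. d q * ind q)"
    using eq by (auto simp: d_def ind_def)
  then have "v d = d p * v ind + ind p * v d"
    using tangent_mult[OF v d ind] by simp
  then have "v d = 0"
    using p eq by (simp add: ind_def d_def)
  moreover have "v d = v f - v h"
    unfolding d_def using tangent_lincomb[OF v True h, of 1 "-1"] by simp
  ultimately show ?thesis by simp
qed

text \<open>Point derivations are combinations of partial derivatives. The coordinates are frozen at \<open>P\<close> one
  after the other: the difference of consecutive stages is \<open>(x\<^sub>m - P\<^sub>m) h(x)\<close> with \<open>h\<close> smooth by Hadamard's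
  lemma, and a derivation sends it to \<open>h(P)\<close> times its value on the \<open>m\<close>-th coordinate function. After the
  last stage a constant is left. Positive definiteness of all inner products below rests on this.\<close>

lemma tangent_expansion:
  assumes v: "v \<in> tangent N p" and p: "p \<in> S" and f: "f \<in> Cinf N"
  shows "v f = (\<Sum>i<n. v (\<lambda>q. \<phi> q i) * pd i (\<lambda>x. f (\<phi>i x)) (\<phi> p))"
proof -
  define F where "F = (\<lambda>x. f (\<phi>i x))"
  define P where "P = \<phi> p"
  have P: "P \<in> cspace n"
    unfolding P_def by (rule chart_mem[OF p])
  have F: "smooth_on n (cspace n) F"
    using f unfolding F_def Cinf_iff .
  define a where "a m j = (if j < m then P j else 0)" for m j :: nat
  define b where "b m j = (if j < m then 0 else 1 :: real)" for m j :: nat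
  define G where "G m x = F (\<lambda>j. a m j + b m j * x j)" for m x
  have ab: "(\<lambda>j. a m j + b m j * x j) \<in> cspace n" if "x \<in> cspace n" for m x
    using that P by (auto simp: cspace_iff a_def b_def)
  have ab_P: "(\<lambda>j. a m j + b m j * P j) = P" for m
    by (auto simp: a_def b_def)
  have G: "smooth_on n (cspace n) (G m)" for m
    unfolding G_def by (rule smooth_affine[OF ab F])
  have step: "v (\<lambda>q. G m (\<phi> q)) = v (\<lambda>q. G (Suc m) (\<phi> q)) + v (\<lambda>q. \<phi> q m) * pd m F P"
    if m: "m < n" for m
  proof -
    obtain h where h: "smooth_on n (cspace n) h"
      and eq: "\<And>x. x \<in> cspace n \<Longrightarrow> G m x - G m (x(m := P m)) = (x m - P m) * h x"
      and h_P: "\<And>x. x m = P m \<Longrightarrow> h x = pd m (G m) x"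
      using hadamard_coordinate[OF G[of m] m, where c = "P m"] by blast
    have "pd m (G m) P = b m m * pd m F (\<lambda>j. a m j + b m j * P j)"
      unfolding G_def by (rule pd_affine[OF ab F m P])
    then have h_val: "h P = pd m F P"
      using h_P[of P] by (simp add: ab_P) (simp add: b_def)
    have G_Suc: "G m (x(m := P m)) = G (Suc m) x" for x
      unfolding G_def by (rule arg_cong[where f = F]) (auto simp: a_def b_def fun_eq_iff less_Suc_eq)
    define l where "l = (\<lambda>q. 1 * \<phi> q m + (- P m) * 1)"
    have l: "l \<in> Cinf N"
      unfolding l_def by (intro Cinf_lincomb Cinf_coord Cinf_const)
    have hC: "(\<lambda>q. h (\<phi> q)) \<in> Cinf N"
      by (rule Cinf_chart[OF h])
    have "v (\<lambda>q. G m (\<phi> q)) = v (\<lambda>q. 1 * G (Suc m) (\<phi> q) + 1 * (l q * h (\<phi> q)))"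
    proof (rule tangent_local[OF v p])
      fix q
      assume "q \<in> S"
      then show "G m (\<phi> q) = 1 * G (Suc m) (\<phi> q) + 1 * (l q * h (\<phi> q))"
        using eq[OF chart_mem] by (simp add: G_Suc l_def algebra_simps)
    qed
    also have "\<dots> = v (\<lambda>q. G (Suc m) (\<phi> q)) + v (\<lambda>q. l q * h (\<phi> q))"
      using tangent_lincomb[OF v Cinf_chart[OF G[of "Suc m"]] Cinf_mult[OF l hC], of 1 1] by simp
    also have "v (\<lambda>q. l q * h (\<phi> q)) = h P * v l"
      using tangent_mult[OF v l hC] by (simp add: l_def P_def)
    also have "v l = v (\<lambda>q. \<phi> q m)"
      unfolding l_def using tangent_lincomb[OF v Cinf_coord[of m] Cinf_const[of 1], where a = 1 and b = "- P m"]
      by (simp add: tangent_const[OF v])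
    finally show ?thesis
      by (simp add: h_val mult.commute)
  qed
  have "v (\<lambda>q. G 0 (\<phi> q)) = v (\<lambda>q. G m (\<phi> q)) + (\<Sum>i<m. v (\<lambda>q. \<phi> q i) * pd i F P)"
    if "m \<le> n" for m
    using that by (induction m) (simp_all add: step)
  from this[of n]
  have "v (\<lambda>q. G 0 (\<phi> q)) = v (\<lambda>q. G n (\<phi> q)) + (\<Sum>i<n. v (\<lambda>q. \<phi> q i) * pd i F P)"
    by simp
  moreover have "v (\<lambda>q. G 0 (\<phi> q)) = v f"
    by (rule tangent_local[OF v p]) (simp add: G_def a_def b_def F_def chart_inv_left)
  moreover have "v (\<lambda>q. G n (\<phi> q)) = v (\<lambda>q. F P)"
  proof (rule tangent_local[OF v p])
    fix q
    assume "q \<in> S"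
    then have "(\<lambda>j. a n j + b n j * \<phi> q j) = P"
      using P chart_mem[of q] by (auto simp: a_def b_def cspace_iff fun_eq_iff)
    then show "G n (\<phi> q) = F P"
      by (simp add: G_def)
  qed
  ultimately show ?thesis
    by (simp add: tangent_const[OF v] F_def P_def)
qed

abbreviation ch where "ch \<equiv> (S, \<phi>)"

lemma coord_vec_apply:
  "f \<in> Cinf N \<Longrightarrow> coord_vec N ch x i f = pd i (\<lambda>x'. f (\<phi>i x')) x"
  by (simp add: coord_vec_def)

lemma coord_vec_coord:
  assumes "x \<in> cspace n" "i < n"
  shows "coord_vec N ch x i (\<lambda>q. \<phi> q j) = (if i = j then 1 else 0)"
  using pd_cong[of n "\<lambda>x. \<phi> (\<phi>i x) j" "\<lambda>x. x j", OF _ assms(2,1)] chart_inv_right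
  by (simp add: coord_vec_apply[OF Cinf_coord] pd_coord)

lemma coord_vec_tangent:
  assumes x: "x \<in> cspace n" and i: "i < n"
  shows "coord_vec N ch x i \<in> tangent N (\<phi>i x)"
proof -
  have "coord_vec N ch x i (\<lambda>q. a * f q + b * h q) = a * coord_vec N ch x i f + b * coord_vec N ch x i h"
    if f: "f \<in> Cinf N" and h: "h \<in> Cinf N" for f h a b
    using pd_add[OF smooth_mult[OF smooth_const f[unfolded Cinf_iff]]
        smooth_mult[OF smooth_const h[unfolded Cinf_iff]] i x, of a b]
      pd_mult[OF smooth_const f[unfolded Cinf_iff] i x, of a]
      pd_mult[OF smooth_const h[unfolded Cinf_iff] i x, of b]
    by (simp add: coord_vec_apply f h Cinf_lincomb pd_const)
  moreover have "coord_vec N ch x i (\<lambda>q. f q * h q) =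
      f (\<phi>i x) * coord_vec N ch x i h + h (\<phi>i x) * coord_vec N ch x i f"
    if f: "f \<in> Cinf N" and h: "h \<in> Cinf N" for f h
    using pd_mult[OF f[unfolded Cinf_iff] h[unfolded Cinf_iff] i x]
    by (simp add: coord_vec_apply f h Cinf_mult)
  ultimately show ?thesis
    by (simp add: tangent_def) (simp add: coord_vec_def)
qed

lemma tangent_zero: "0 \<in> tangent N p"
  by (simp add: tangent_def)

lemma tangent_add: "v \<in> tangent N p \<Longrightarrow> w \<in> tangent N p \<Longrightarrow> v + w \<in> tangent N p"
  by (simp add: tangent_def algebra_simps)

lemma tangent_scale: "v \<in> tangent N p \<Longrightarrow> r *\<^sub>R v \<in> tangent N p"
  by (simp add: tangent_def scaleR_fun_def algebra_simps)

lemma subspace_tangent: "subspace (tangent N p)"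
  by (simp add: subspace_def tangent_zero tangent_add tangent_scale)

lemma tangent_eqI:
  assumes v: "v \<in> tangent N p" and w: "w \<in> tangent N p" and p: "p \<in> S"
    and eq: "\<And>i. i < n \<Longrightarrow> v (\<lambda>q. \<phi> q i) = w (\<lambda>q. \<phi> q i)"
  shows "v = w"
proof
  show "v f = w f" for f
    by (cases "f \<in> Cinf N")
      (simp_all add: tangent_expansion[OF v p] tangent_expansion[OF w p] eq
        tangent_outside[OF v] tangent_outside[OF w])
qed

lemma of_components_tangent:
  assumes "x \<in> cspace n"
  shows "of_components N ch x y \<in> tangent N (\<phi>i x)"
  unfolding of_components_def
  by (intro subspace_sum[OF subspace_tangent] tangent_scale coord_vec_tangent[OF assms]) simp

lemma of_components_coord:
  assumes "x \<in> cspace n" "j < n"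
  shows "of_components N ch x y (\<lambda>q. \<phi> q j) = y j"
proof -
  have "of_components N ch x y (\<lambda>q. \<phi> q j) = (\<Sum>i<n. y i * (if i = j then 1 else 0))"
    unfolding of_components_def sum_fun_apply
    using assms(1) by (intro sum.cong) (auto simp: scaleR_fun_def coord_vec_coord)
  then show ?thesis
    using assms(2) by (simp add: if_distrib[of "(*) _"] cong: if_cong)
qed

lemma components_eq:
  assumes p: "p \<in> S" and v: "v \<in> tangent N p"
  shows "components N ch p v = (\<lambda>i. if i < n then v (\<lambda>q. \<phi> q i) else 0)"
  unfolding components_def snd_conv
proof (rule the_equality)
  have inv: "\<phi>i (\<phi> p) = p"
    by (rule chart_inv_left[OF p])
  show "(\<forall>i\<ge>n. (if i < n then v (\<lambda>q. \<phi> q i) else 0) = 0) \<and>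
      of_components N ch (\<phi> p) (\<lambda>i. if i < n then v (\<lambda>q. \<phi> q i) else 0) = v"
    using tangent_eqI[OF _ v p] of_components_tangent[OF chart_mem[OF p]]
      of_components_coord[OF chart_mem[OF p]] by (simp add: inv)
  show "y = (\<lambda>i. if i < n then v (\<lambda>q. \<phi> q i) else 0)"
    if "(\<forall>i\<ge>n. y i = 0) \<and> of_components N ch (\<phi> p) y = v" for y
    using that of_components_coord[OF chart_mem[OF p], of _ y] by (auto simp: fun_eq_iff)
qed

lemma chart_at_eq: "p \<in> S \<Longrightarrow> chart_at N p = ch"
  unfolding chart_at_def atlas by (rule some_equality) auto

text \<open>The components of a vector in the coordinate basis are its values on the coordinate functions.\<close>

definition diagonal_form :: "(nat \<Rightarrow> real) \<Rightarrow> 'a tvec \<Rightarrow> 'a tvec \<Rightarrow> real" where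
  "diagonal_form a v w = (\<Sum>i<n. a i * v (\<lambda>q. \<phi> q i) * w (\<lambda>q. \<phi> q i))"

lemma inner_product_diagonal_form:
  assumes p: "p \<in> S" and pos: "\<And>i. i < n \<Longrightarrow> a i > 0"
  shows "inner_product_on (tangent N p) (diagonal_form a)"
proof -
  have "diagonal_form a v v > 0" if v: "v \<in> tangent N p" and "v \<noteq> 0" for v
  proof -
    obtain j where j: "j < n" "v (\<lambda>q. \<phi> q j) \<noteq> 0"
      using tangent_eqI[OF v tangent_zero p] \<open>v \<noteq> 0\<close> by auto
    have "0 < a j * v (\<lambda>q. \<phi> q j) * v (\<lambda>q. \<phi> q j)"
      using pos[OF j(1)] j(2) by (metis mult.assoc mult_pos_pos not_real_square_gt_zero)
    then show ?thesis
      unfolding diagonal_form_def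
      using pos j(1) by (intro sum_pos2[of _ j]) (auto simp: mult.assoc less_imp_le)
  qed
  then show ?thesis
    unfolding inner_product_on_def
    by (auto simp: diagonal_form_def scaleR_fun_def algebra_simps sum.distrib sum_distrib_left)
qed

lemma diagonal_form_coord_vec:
  assumes "x \<in> cspace n" "i < n" "j < n"
  shows "diagonal_form a (coord_vec N ch x i) (coord_vec N ch x j) = (if i = j then a i else 0)"
proof -
  have "diagonal_form a (coord_vec N ch x i) (coord_vec N ch x j) =
      (\<Sum>k<n. if k = i then if i = j then a i else 0 else 0)"
    unfolding diagonal_form_def
    using assms by (intro sum.cong) (auto simp: coord_vec_coord)
  then show ?thesis
    using assms by simp
qed

end

lemma smooth_map_global_chart:
  assumes "global_chart N \<phi>" "global_chart N' \<psi>"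
    and cont: "continuous_map (mtop N) (mtop N') F"
    and smooth: "\<And>i. i < mdim N' \<Longrightarrow> smooth_on (mdim N) (cspace (mdim N))
      (\<lambda>x. \<psi> (F (inv_into (topspace (mtop N)) \<phi> x)) i)"
  shows "smooth_map N N' F"
proof -
  interpret N: global_chart N \<phi> by fact
  interpret N': global_chart N' \<psi> by fact
  have "{p \<in> N.S. F p \<in> N'.S} = N.S"
    using continuous_map_image_subset_topspace[OF cont] by auto
  then show ?thesis
    unfolding smooth_map_def N.atlas N'.atlas using cont smooth by (simp add: N.chart_image)
qed

lemma differential_tangent:
  assumes "global_chart N' \<psi>"
    and pull: "\<And>f. f \<in> Cinf N' \<Longrightarrow> (\<lambda>p. f (F p)) \<in> Cinf N"
    and v: "v \<in> tangent N p"
  shows "differential N' F v \<in> tangent N' (F p)"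
proof -
  interpret N': global_chart N' \<psi> by fact
  show ?thesis
    using v pull by (simp add: tangent_def differential_def N'.Cinf_lincomb N'.Cinf_mult)
qed

lemma differential_apply: "f \<in> Cinf N' \<Longrightarrow> differential N' F v f = v (\<lambda>p. f (F p))"
  by (simp add: differential_def)

section \<open>The affine group of the line\<close>

text \<open>The orientation preserving affine maps \<open>z \<mapsto> e\<^sup>t z + s\<close> of the line, with coordinates \<open>s\<close> (index 0) and
  \<open>t\<close> (index 1). In these coordinates the group is all of the plane.\<close>

definition aff_mult :: "coord \<Rightarrow> coord \<Rightarrow> coord" where
  "aff_mult a b = (\<lambda>i. if i = 0 then a 0 + exp (a 1) * b 0 else if i = 1 then a 1 + b 1 else 0)"

definition aff :: "coord monoid" where
  "aff = \<lparr>carrier = cspace 2, mult = aff_mult, one = \<lambda>_. 0\<rparr>"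

definition aff_inv :: "coord \<Rightarrow> coord" where
  "aff_inv a = (\<lambda>i. if i = 0 then - (exp (- a 1) * a 0) else if i = 1 then - a 1 else 0)"

definition aff_mfd :: "coord mfd" where
  "aff_mfd = \<lparr>mtop = Euclidean_space 2, mdim = 2, atlas = {(cspace 2, \<lambda>x. x)}\<rparr>"

text \<open>The cosets of the trivial subgroup are the singletons; the manifold structure is carried over
  along \<^const>\<open>the_elem\<close>.\<close>

definition hyp_plane :: "coord set mfd" where
  "hyp_plane = \<lparr>mtop = pullback_topology ((\<lambda>a. {a}) ` cspace 2) the_elem (Euclidean_space 2), mdim = 2,
     atlas = {((\<lambda>a. {a}) ` cspace 2, the_elem)}\<rparr>"

lemma aff_simps [simp]:
  "carrier aff = cspace 2" "mult aff = aff_mult" "one aff = (\<lambda>_. 0)"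
  by (simp_all add: aff_def)

lemma aff_mfd_simps [simp]: "mtop aff_mfd = Euclidean_space 2" "mdim aff_mfd = 2"
  by (simp_all add: aff_mfd_def)

lemma hyp_simps [simp]: "topspace (mtop hyp_plane) = (\<lambda>a. {a}) ` cspace 2" "mdim hyp_plane = 2"
  by (auto simp: hyp_plane_def topspace_pullback_topology)

lemma zero_cspace [simp]: "(\<lambda>_. 0) \<in> cspace n"
  by (simp add: cspace_iff)

lemma less_2_cases: "(i::nat) < 2 \<longleftrightarrow> i = 0 \<or> i = 1"
  by auto

lemma cspace2_eqI: "x \<in> cspace 2 \<Longrightarrow> y \<in> cspace 2 \<Longrightarrow> x 0 = y 0 \<Longrightarrow> x 1 = y 1 \<Longrightarrow> x = y"
  by (metis cspace_iff ext less_2_cases not_le)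

lemma aff_mult_mem [simp]: "aff_mult a b \<in> cspace 2"
  by (simp add: cspace_iff aff_mult_def)

lemma aff_inv_mem [simp]: "aff_inv a \<in> cspace 2"
  by (simp add: cspace_iff aff_inv_def)

lemma aff_mult_one [simp]: "a \<in> cspace 2 \<Longrightarrow> aff_mult a (\<lambda>_. 0) = a"
  and aff_one_mult [simp]: "a \<in> cspace 2 \<Longrightarrow> aff_mult (\<lambda>_. 0) a = a"
  by (auto intro!: cspace2_eqI simp: aff_mult_def cspace_iff)

lemma aff_inv_mult: "a \<in> cspace 2 \<Longrightarrow> aff_mult (aff_inv a) a = (\<lambda>_. 0)"
  by (rule cspace2_eqI) (auto simp: aff_mult_def aff_inv_def cspace_iff)

lemma aff_mult_assoc: "aff_mult (aff_mult a b) d = aff_mult a (aff_mult b d)"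
  by (rule cspace2_eqI) (auto simp: aff_mult_def cspace_iff exp_add algebra_simps)

lemma aff_group: "group aff"
proof (rule groupI)
  show "\<exists>y\<in>carrier aff. y \<otimes>\<^bsub>aff\<^esub> x = \<one>\<^bsub>aff\<^esub>" if "x \<in> carrier aff" for x
    using that aff_inv_mult by (auto intro: bexI[of _ "aff_inv x"])
qed (simp_all add: aff_mult_assoc)

lemma aff_m_inv: "a \<in> cspace 2 \<Longrightarrow> inv\<^bsub>aff\<^esub> a = aff_inv a"
  using group.inv_equality[OF aff_group, of "aff_inv a" a] by (simp add: aff_inv_mult)

lemma coset_proj_aff: "coset_proj aff {\<lambda>_. 0} a = {aff_mult a (\<lambda>_. 0)}"
  by (simp add: coset_proj_def l_coset_def)

lemma translation_aff: "translation aff a {b} = {aff_mult a b}"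
  by (simp add: translation_def l_coset_def)

lemma lcosets_aff: "lcosets\<^bsub>aff\<^esub> {\<lambda>_. 0} = (\<lambda>a. {a}) ` cspace 2"
  by (auto simp: LCOSETS_def l_coset_def)

lemma homeomorphic_map_hyp: "homeomorphic_map (mtop hyp_plane) (Euclidean_space 2) the_elem"
proof (rule bijective_open_imp_homeomorphic_map)
  show "continuous_map (mtop hyp_plane) (Euclidean_space 2) the_elem"
    unfolding continuous_map_def hyp_simps by (auto simp: hyp_plane_def openin_pullback_topology)
  have "the_elem ` (the_elem -` U \<inter> (\<lambda>a. {a}) ` cspace 2) = U"
    if "openin (Euclidean_space 2) U" for U
    using openin_subset[OF that] by force
  then show "open_map (mtop hyp_plane) (Euclidean_space 2) the_elem"
    unfolding open_map_def by (auto simp: hyp_plane_def openin_pullback_topology)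
qed (auto simp: image_image inj_on_def)

interpretation AM: global_chart aff_mfd "\<lambda>x. x"
proof
  show "homeomorphic_map (mtop aff_mfd) (Euclidean_space (mdim aff_mfd)) (\<lambda>x. x)"
    using homeomorphic_map_id[of "Euclidean_space 2" "Euclidean_space 2"] by (simp add: id_def)
qed (simp add: aff_mfd_def)

interpretation HQ: global_chart hyp_plane the_elem
proof
  show "homeomorphic_map (mtop hyp_plane) (Euclidean_space (mdim hyp_plane)) the_elem"
    using homeomorphic_map_hyp by simp
qed (simp only: hyp_simps, simp add: hyp_plane_def)

lemma AM_inv: "x \<in> cspace 2 \<Longrightarrow> AM.\<phi>i x = x"
  using AM.chart_inv_right[of x] by simp

lemma HQ_inv: "x \<in> cspace 2 \<Longrightarrow> HQ.\<phi>i x = {x}"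
  using HQ.chart_inv_left[of "{x}"] by simp

lemma Cinf_aff_mfd: "f \<in> Cinf aff_mfd \<longleftrightarrow> smooth_on 2 (cspace 2) f"
  unfolding AM.Cinf_iff using smooth_on_cong[of 2 "\<lambda>x. f (AM.\<phi>i x)" f] AM_inv by simp

lemma Cinf_hyp: "f \<in> Cinf hyp_plane \<longleftrightarrow> smooth_on 2 (cspace 2) (\<lambda>x. f {x})"
  unfolding HQ.Cinf_iff using smooth_on_cong[of 2 "\<lambda>x. f (HQ.\<phi>i x)" "\<lambda>x. f {x}"] HQ_inv by simp

lemma aff_mult_affine:
  "a \<in> cspace 2 \<Longrightarrow> x \<in> cspace 2 \<Longrightarrow>
    aff_mult a x = (\<lambda>j. a j + (if j = 0 then exp (a 1) else 1) * x j)"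
  by (rule cspace2_eqI) (simp_all add: aff_mult_def cspace_iff)

lemma smooth_left_translation:
  assumes a: "a \<in> cspace 2" and f: "smooth_on 2 (cspace 2) f"
  shows "smooth_on 2 (cspace 2) (\<lambda>x. f (aff_mult a x))"
proof -
  have mem: "(\<lambda>j. a j + (if j = 0 then exp (a 1) else 1) * x j) \<in> cspace 2" if "x \<in> cspace 2" for x
    using aff_mult_mem[of a x] unfolding aff_mult_affine[OF a that] .
  show ?thesis
    using smooth_affine[OF mem f] aff_mult_affine[OF a]
      smooth_on_cong[of 2 "\<lambda>x. f (aff_mult a x)"
        "\<lambda>x. f (\<lambda>j. a j + (if j = 0 then exp (a 1) else 1) * x j)"] by simp
qed

lemma pd_left_translation:
  assumes a: "a \<in> cspace 2" and f: "smooth_on 2 (cspace 2) f" and i: "i < 2"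
  shows "pd i (\<lambda>x. f (aff_mult a x)) (\<lambda>_. 0) = (if i = 0 then exp (a 1) else 1) * pd i f a"
proof -
  have mem: "(\<lambda>j. a j + (if j = 0 then exp (a 1) else 1) * x j) \<in> cspace 2" if "x \<in> cspace 2" for x
    using aff_mult_mem[of a x] unfolding aff_mult_affine[OF a that] .
  have "pd i (\<lambda>x. f (aff_mult a x)) (\<lambda>_. 0) =
      pd i (\<lambda>x. f (\<lambda>j. a j + (if j = 0 then exp (a 1) else 1) * x j)) (\<lambda>_. 0)"
    using aff_mult_affine[OF a] by (intro pd_cong[of 2] i zero_cspace) simp
  also have "\<dots> = (if i = 0 then exp (a 1) else 1) *
      pd i f (\<lambda>j. a j + (if j = 0 then exp (a 1) else 1) * 0)"
    by (rule pd_affine[OF mem f i zero_cspace])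
  finally show ?thesis by simp
qed

lemma continuous_on_aff_mult:
  "continuous_on (S \<times> T) (\<lambda>z. aff_mult (fst z) (snd z))"
proof (rule continuous_on_coordinatewise_then_product)
  fix i
  have "continuous_on (S \<times> T) (\<lambda>z::coord \<times> coord. fst z j)" for j
    by (rule continuous_on_compose2[OF continuous_on_coord continuous_on_fst[OF continuous_on_id] subset_UNIV])
  moreover have "continuous_on (S \<times> T) (\<lambda>z::coord \<times> coord. snd z j)" for j
    by (rule continuous_on_compose2[OF continuous_on_coord continuous_on_snd[OF continuous_on_id] subset_UNIV])
  ultimately show "continuous_on (S \<times> T) (\<lambda>z. aff_mult (fst z) (snd z) i)"
    unfolding aff_mult_def
    by (cases "i = 0"; cases "i = 1") (auto intro!: continuous_intros)
qed

lemma smooth_aff_mult: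
  "smooth_map (prod_mfd aff_mfd aff_mfd) aff_mfd (\<lambda>(a, b). a \<otimes>\<^bsub>aff\<^esub> b)"
proof -
  define \<psi> :: "coord \<times> coord \<Rightarrow> coord" where
    "\<psi> = (\<lambda>(p, q) i. if i < 2 then p i else q (i - 2))"
  define \<psi>i :: "coord \<Rightarrow> coord \<times> coord" where
    "\<psi>i x = (\<lambda>i. if i < 2 then x i else 0, \<lambda>i. if i < 2 then x (i + 2) else 0)" for x
  \<comment> \<open>\<open>\<psi>\<close> is the chart of the product manifold: it places the coordinates of the two factors side by side.\<close>
  have \<psi>i: "\<psi>i x \<in> cspace 2 \<times> cspace 2" for x
    by (simp add: \<psi>i_def cspace_iff)
  have \<psi>_inv: "\<psi> (\<psi>i x) = x" if "x \<in> cspace 4" for x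
  proof
    have "i - 2 + 2 = i" if "\<not> i < 2" for i :: nat
      using that by simp
    then show "\<psi> (\<psi>i x) i = x i" for i
      using that by (simp add: \<psi>_def \<psi>i_def cspace_iff del: add_2_eq_Suc')
  qed
  have inv_\<psi>: "\<psi>i (\<psi> z) = z" if "z \<in> cspace 2 \<times> cspace 2" for z
    using that by (auto simp: \<psi>_def \<psi>i_def cspace_iff fun_eq_iff)
  have \<psi>_mem: "\<psi> z \<in> cspace 4" if "z \<in> cspace 2 \<times> cspace 2" for z
    using that by (auto simp: \<psi>_def cspace_iff)
  have image: "\<psi> ` (cspace 2 \<times> cspace 2) = cspace 4"
  proof
    show "cspace 4 \<subseteq> \<psi> ` (cspace 2 \<times> cspace 2)"
    proof
      show "x \<in> \<psi> ` (cspace 2 \<times> cspace 2)" if "x \<in> cspace 4" for x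
        using image_eqI[of x \<psi> "\<psi>i x" "cspace 2 \<times> cspace 2"] \<psi>_inv[OF that] \<psi>i[of x] by simp
    qed
  qed (use \<psi>_mem in blast)
  have inj: "inj_on \<psi> (cspace 2 \<times> cspace 2)"
    by (rule inj_on_inverseI[where g = \<psi>i]) (rule inv_\<psi>)
  have inv: "inv_into (cspace 2 \<times> cspace 2) \<psi> x = \<psi>i x" if "x \<in> cspace 4" for x
    using inv_into_f_eq[OF inj \<psi>i \<psi>_inv[OF that]] .
  have atlas: "atlas (prod_mfd aff_mfd aff_mfd) = {(cspace 2 \<times> cspace 2, \<psi>)}"
    unfolding prod_mfd_def AM.atlas \<psi>_def aff_mfd_simps by auto
  have "smooth_on 4 (cspace 4)
      (\<lambda>x. aff_mult (fst (inv_into (cspace 2 \<times> cspace 2) \<psi> x)) (snd (inv_into (cspace 2 \<times> cspace 2) \<psi> x)) i)"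
    if i: "i < 2" for i
  proof -
    have "smooth_on 4 (cspace 4) (\<lambda>x. if i = 0 then x 0 + exp (x 1) * x 2 else x 1 + x 3)"
      by (cases "i = 0") (simp_all add: smooth_add smooth_mult smooth_exp smooth_coord)
    moreover have "aff_mult (fst (inv_into (cspace 2 \<times> cspace 2) \<psi> x))
        (snd (inv_into (cspace 2 \<times> cspace 2) \<psi> x)) i =
        (if i = 0 then x 0 + exp (x 1) * x 2 else x 1 + x 3)" if "x \<in> cspace 4" for x
      using i unfolding inv[OF that] less_2_cases by (auto simp: aff_mult_def \<psi>i_def numeral_2_eq_2 numeral_3_eq_3)
    ultimately show ?thesis
      using smooth_on_cong[of 4 "\<lambda>x. aff_mult (fst (inv_into (cspace 2 \<times> cspace 2) \<psi> x))
        (snd (inv_into (cspace 2 \<times> cspace 2) \<psi> x)) i"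
        "\<lambda>x. if i = 0 then x 0 + exp (x 1) * x 2 else x 1 + x 3"] by blast
  qed
  moreover have "continuous_map (prod_topology (Euclidean_space 2) (Euclidean_space 2))
      (Euclidean_space 2) (\<lambda>z. aff_mult (fst z) (snd z))"
    using continuous_on_aff_mult aff_mult_mem[unfolded cspace_iff]
    unfolding Euclidean_space_eq_top_of_set prod_topology_subtopology_eu continuous_map_in_subtopology
    by auto
  moreover have "{p \<in> cspace 2 \<times> cspace 2. (case p of (a, b) \<Rightarrow> aff_mult a b) \<in> cspace 2} =
      cspace 2 \<times> cspace 2"
    by auto
  moreover have "mtop (prod_mfd aff_mfd aff_mfd) = prod_topology (Euclidean_space 2) (Euclidean_space 2)"
    "mdim (prod_mfd aff_mfd aff_mfd) = 4"
    by (simp_all add: prod_mfd_def)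
  ultimately show ?thesis
    unfolding smooth_map_def atlas AM.atlas by (simp add: image case_prod_beta')
qed

lemma smooth_aff_inv: "smooth_map aff_mfd aff_mfd (\<lambda>a. inv\<^bsub>aff\<^esub> a)"
proof (rule smooth_map_global_chart[OF AM.global_chart_axioms AM.global_chart_axioms])
  have "continuous_on (cspace 2) aff_inv"
  proof (rule continuous_on_coordinatewise_then_product)
    show "continuous_on (cspace 2) (\<lambda>a. aff_inv a i)" for i
      unfolding aff_inv_def
      by (cases "i = 0"; cases "i = 1") (auto intro!: continuous_intros continuous_on_coord)
  qed
  then have "continuous_map (Euclidean_space 2) (Euclidean_space 2) aff_inv"
    using aff_inv_mem[unfolded cspace_iff] unfolding topspace_Euclidean_space
    unfolding Euclidean_space_eq_top_of_set continuous_map_in_subtopology by auto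
  then show "continuous_map (mtop aff_mfd) (mtop aff_mfd) (\<lambda>a. inv\<^bsub>aff\<^esub> a)"
    unfolding aff_mfd_simps by (rule continuous_map_eq) (simp add: aff_m_inv)
  fix i :: nat
  have "smooth_on 2 (cspace 2) (\<lambda>a. if i = 0 then (-1) * (exp ((-1) * a 1) * a 0)
      else if i = 1 then (-1) * a 1 else 0)"
    by (cases "i = 0"; cases "i = 1")
      (simp_all only: simp_thms if_True if_False smooth_mult smooth_exp smooth_coord smooth_const)
  moreover have "(inv\<^bsub>aff\<^esub> (AM.\<phi>i a)) i = (if i = 0 then (-1) * (exp ((-1) * a 1) * a 0)
      else if i = 1 then (-1) * a 1 else 0)" if "a \<in> cspace 2" for a
    using that by (simp add: aff_m_inv AM_inv aff_inv_def)
  ultimately show "smooth_on (mdim aff_mfd) (cspace (mdim aff_mfd)) (\<lambda>x. (inv\<^bsub>aff\<^esub> (AM.\<phi>i x)) i)"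
    using smooth_on_cong[of 2 "\<lambda>x. (inv\<^bsub>aff\<^esub> (AM.\<phi>i x)) i" "\<lambda>a. if i = 0 then (-1) * (exp ((-1) * a 1) * a 0)
      else if i = 1 then (-1) * a 1 else 0"] by simp
qed

lemma lie_group_aff: "lie_group aff aff_mfd"
  unfolding lie_group_def
  using aff_group AM.smooth_manifold smooth_aff_mult smooth_aff_inv by simp

section \<open>The coset space of the trivial subgroup\<close>

lemma coset_proj_aff_mem: "a \<in> cspace 2 \<Longrightarrow> coset_proj aff {\<lambda>_. 0} a = {a}"
  by (simp add: coset_proj_aff)

lemma homogeneous_manifold_hyp: "homogeneous_manifold aff aff_mfd {\<lambda>_. 0} hyp_plane"
proof -
  let ?\<pi> = "coset_proj aff {\<lambda>_. 0}"
  obtain h where h: "homeomorphic_maps (mtop hyp_plane) (Euclidean_space 2) the_elem h"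
    using homeomorphic_map_hyp unfolding homeomorphic_map_maps by blast
  then have h_hom: "homeomorphic_map (Euclidean_space 2) (mtop hyp_plane) h"
    unfolding homeomorphic_maps_map by blast
  have "h x = ?\<pi> x" if x: "x \<in> cspace 2" for x
  proof -
    have "h x \<in> topspace (mtop hyp_plane)"
      using homeomorphic_imp_surjective_map[OF h_hom] x by blast
    then obtain y where "h x = {y}"
      unfolding hyp_simps by blast
    moreover have "the_elem (h x) = x"
      using h x unfolding homeomorphic_maps_def by blast
    ultimately show ?thesis
      by (simp add: coset_proj_aff_mem[OF x])
  qed
  then have \<pi>: "homeomorphic_map (Euclidean_space 2) (mtop hyp_plane) ?\<pi>"
    by (rule homeomorphic_map_eq[OF h_hom])
  have smooth: "smooth_map aff_mfd hyp_plane ?\<pi>"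
  proof (rule smooth_map_global_chart[OF AM.global_chart_axioms HQ.global_chart_axioms])
    show "continuous_map (mtop aff_mfd) (mtop hyp_plane) ?\<pi>"
      using \<pi> homeomorphic_imp_continuous_map by simp
    show "smooth_on (mdim aff_mfd) (cspace (mdim aff_mfd)) (\<lambda>x. the_elem (?\<pi> (AM.\<phi>i x)) i)" for i
      using smooth_on_cong[of 2 "\<lambda>x. the_elem (?\<pi> (AM.\<phi>i x)) i" "\<lambda>x. x i"] smooth_coord
      by (simp add: AM_inv coset_proj_aff_mem)
  qed
  have pull: "(\<lambda>p. f (?\<pi> p)) \<in> Cinf aff_mfd" if "f \<in> Cinf hyp_plane" for f
    using that smooth_on_cong[of 2 "\<lambda>p. f (?\<pi> p)" "\<lambda>p. f {p}"]
    by (simp add: Cinf_aff_mfd Cinf_hyp coset_proj_aff_mem)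
  have pull': "(\<lambda>\<xi>. f (the_elem \<xi>)) \<in> Cinf hyp_plane" if "f \<in> Cinf aff_mfd" for f
    using that by (simp add: Cinf_aff_mfd Cinf_hyp)
  have "differential hyp_plane ?\<pi> ` tangent aff_mfd a = tangent hyp_plane (?\<pi> a)" if a: "a \<in> cspace 2" for a
  proof
    show "differential hyp_plane ?\<pi> ` tangent aff_mfd a \<subseteq> tangent hyp_plane (?\<pi> a)"
      using differential_tangent[where F = ?\<pi> and N = aff_mfd, OF HQ.global_chart_axioms pull] by blast
    show "tangent hyp_plane (?\<pi> a) \<subseteq> differential hyp_plane ?\<pi> ` tangent aff_mfd a"
    proof
      fix v
      assume "v \<in> tangent hyp_plane (?\<pi> a)"
      then have v: "v \<in> tangent hyp_plane {a}"
        using a by (simp add: coset_proj_aff_mem)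
      have "differential aff_mfd the_elem v \<in> tangent aff_mfd (the_elem {a})"
        by (rule differential_tangent[OF AM.global_chart_axioms pull' v])
      moreover have "differential hyp_plane ?\<pi> (differential aff_mfd the_elem v) f = v f" for f
      proof (cases "f \<in> Cinf hyp_plane")
        case True
        have "v (\<lambda>\<xi>. f (?\<pi> (the_elem \<xi>))) = v f"
          using a by (intro HQ.tangent_local[OF v]) (auto simp: coset_proj_aff_mem)
        then show ?thesis
          by (simp add: differential_apply True pull)
      next
        case False
        then show ?thesis
          using HQ.tangent_outside[OF v] by (simp add: differential_def)
      qed
      then have "v = differential hyp_plane ?\<pi> (differential aff_mfd the_elem v)"
        by auto
      ultimately show "v \<in> differential hyp_plane ?\<pi> ` tangent aff_mfd a"
        by (metis image_eqI the_elem_eq)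
    qed
  qed
  then show ?thesis
    unfolding homogeneous_manifold_def
    using HQ.smooth_manifold \<pi> smooth
    by (simp add: lcosets_aff homeomorphic_map_def)
qed

lemma tangent_proj_mem:
  assumes "v \<in> tangent aff_mfd a" "a \<in> cspace 2"
  shows "differential hyp_plane (coset_proj aff {\<lambda>_. 0}) v \<in> tangent hyp_plane {a}"
proof -
  let ?\<pi> = "coset_proj aff {\<lambda>_. 0}"
  have "differential hyp_plane ?\<pi> ` tangent aff_mfd a = tangent hyp_plane (?\<pi> a)"
    using homogeneous_manifold_hyp assms(2) unfolding homogeneous_manifold_def aff_simps by blast
  then show ?thesis
    using assms(1) coset_proj_aff_mem[OF assms(2)] by auto
qed

lemma tangent_proj_coord:
  assumes v: "v \<in> tangent aff_mfd a" and a: "a \<in> cspace 2"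
  shows "differential hyp_plane (coset_proj aff {\<lambda>_. 0}) v (\<lambda>q. the_elem q j) = v (\<lambda>p. p j)"
proof -
  have "v (\<lambda>p. the_elem (coset_proj aff {\<lambda>_. 0} p) j) = v (\<lambda>p. p j)"
    using a by (intro AM.tangent_local[OF v]) (auto simp: coset_proj_aff_mem)
  then show ?thesis
    by (simp add: differential_apply[OF HQ.Cinf_coord])
qed

section \<open>The Lie algebra\<close>

lemma subgroup_lie_algebra_trivial:
  "subgroup_lie_algebra aff aff_mfd {\<lambda>_. 0} = {0}"
proof -
  have "velocity aff_mfd \<gamma> = 0" if "range \<gamma> \<subseteq> {\<lambda>_. 0}" for \<gamma>
  proof -
    have \<gamma>: "\<gamma> = (\<lambda>_. \<lambda>_. 0)"
      using that by auto
    show ?thesis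
      unfolding \<gamma> by (auto simp: velocity_def fun_eq_iff)
  qed
  moreover have "smooth_map line_mfd aff_mfd (\<lambda>_. \<lambda>_. 0)"
  proof -
    have "range (\<lambda>t i. if i = 0 then t else 0 :: real) = cspace 1"
    proof
      show "cspace 1 \<subseteq> range (\<lambda>t i. if i = 0 then t else 0 :: real)"
      proof
        fix x :: coord
        assume "x \<in> cspace 1"
        then have "x = (\<lambda>i. if i = 0 then x 0 else 0)"
          by (auto simp: cspace_iff fun_eq_iff)
        then show "x \<in> range (\<lambda>t i. if i = 0 then t else 0 :: real)"
          by (rule image_eqI) simp
      qed
    qed (auto simp: cspace_iff)
    then show ?thesis
      unfolding smooth_map_def AM.atlas by (simp add: line_mfd_def smooth_const)
  qed
  moreover have "velocity aff_mfd (\<lambda>_. \<lambda>_. 0) = 0"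
    by (auto simp: velocity_def fun_eq_iff)
  ultimately show ?thesis
    unfolding subgroup_lie_algebra_def
    by (auto intro!: exI[of _ "\<lambda>_. \<lambda>_. 0"])
qed

lemma Ad_one:
  assumes v: "v \<in> tangent aff_mfd (\<lambda>_. 0)"
  shows "Ad aff aff_mfd (\<lambda>_. 0) v = v"
proof
  have inv: "inv\<^bsub>aff\<^esub> (\<lambda>_. 0) = (\<lambda>_. 0)"
    by (auto simp: aff_m_inv aff_inv_def)
  have "v (\<lambda>a. f (aff_mult (aff_mult (\<lambda>_. 0) a) (\<lambda>_. 0))) = v f" for f
    by (rule AM.tangent_local[OF v]) simp_all
  then show "Ad aff aff_mfd (\<lambda>_. 0) v f = v f" for f
    using AM.tangent_outside[OF v] by (simp add: Ad_def differential_def inv)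
qed

text \<open>The curvature formula projects the bracket to the subalgebra by a definite description, which says nothing about
  vectors outside the Lie algebra. The left invariant extension \<open>L W f\<close> of \<open>W\<close> maps smooth functions to smooth
  functions and satisfies the product rule; applying a second derivation produces the mixed terms
  \<open>(V f) (W h) + (W f) (V h)\<close>, which are symmetric in \<open>V\<close> and \<open>W\<close> and cancel in the commutator.\<close>

lemma lie_bracket_tangent:
  assumes Y: "Y \<in> tangent aff_mfd (\<lambda>_. 0)" and U: "U \<in> tangent aff_mfd (\<lambda>_. 0)"
  shows "lie_bracket aff aff_mfd Y U \<in> tangent aff_mfd (\<lambda>_. 0)"
proof -
  define L where "L W f a = W (\<lambda>b. f (aff_mult a b))" for W :: "coord tvec" and f a
  have trans: "(\<lambda>b. f (aff_mult a b)) \<in> Cinf aff_mfd" if "f \<in> Cinf aff_mfd" "a \<in> cspace 2" for f a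
    using smooth_left_translation[OF that(2)] that(1) by (simp add: Cinf_aff_mfd)
  have L_Cinf: "L W f \<in> Cinf aff_mfd" if W: "W \<in> tangent aff_mfd (\<lambda>_. 0)" and f: "f \<in> Cinf aff_mfd" for W f
  proof -
    have "L W f a = W (\<lambda>q. q 0) * (exp (a 1) * pd 0 f a) + W (\<lambda>q. q 1) * pd 1 f a"
      if a: "a \<in> cspace 2" for a
    proof -
      have "pd i (\<lambda>x. f (aff_mult a (AM.\<phi>i x))) (\<lambda>_. 0) =
          (if i = 0 then exp (a 1) else 1) * pd i f a" if i: "i < 2" for i
      proof -
        have "pd i (\<lambda>x. f (aff_mult a (AM.\<phi>i x))) (\<lambda>_. 0) = pd i (\<lambda>x. f (aff_mult a x)) (\<lambda>_. 0)"
          by (rule pd_cong[OF _ i zero_cspace]) (simp add: AM_inv)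
        then show ?thesis
          using pd_left_translation[OF a _ i] f by (simp add: Cinf_aff_mfd)
      qed
      then show ?thesis
        unfolding L_def
        using AM.tangent_expansion[OF W _ trans[OF f a]] by (simp add: numeral_2_eq_2)
    qed
    moreover have "smooth_on 2 (cspace 2)
        (\<lambda>a. W (\<lambda>q. q 0) * (exp (a 1) * pd 0 f a) + W (\<lambda>q. q 1) * pd 1 f a)"
      using f unfolding Cinf_aff_mfd
      by (intro smooth_add smooth_mult smooth_const smooth_exp smooth_coord smooth_pd) auto
    ultimately show ?thesis
      unfolding Cinf_aff_mfd
      using smooth_on_cong[of 2 "L W f"
          "\<lambda>a. W (\<lambda>q. q 0) * (exp (a 1) * pd 0 f a) + W (\<lambda>q. q 1) * pd 1 f a"] by blast
  qed
  have L_one: "L W f (\<lambda>_. 0) = W f" if W: "W \<in> tangent aff_mfd (\<lambda>_. 0)" for W f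
    unfolding L_def by (rule AM.tangent_local[OF W]) simp_all
  have lincomb: "V (L W (\<lambda>q. r * f q + s * h q)) = r * V (L W f) + s * V (L W h)"
    if V: "V \<in> tangent aff_mfd (\<lambda>_. 0)" and W: "W \<in> tangent aff_mfd (\<lambda>_. 0)"
      and f: "f \<in> Cinf aff_mfd" and h: "h \<in> Cinf aff_mfd" for V W f h r s
  proof -
    have "V (L W (\<lambda>q. r * f q + s * h q)) = V (\<lambda>a. r * L W f a + s * L W h a)"
      unfolding L_def
      by (rule AM.tangent_local[OF V]) (simp_all add: AM.tangent_lincomb[OF W trans[OF f] trans[OF h]])
    then show ?thesis
      by (simp add: AM.tangent_lincomb[OF V L_Cinf[OF W f] L_Cinf[OF W h]])
  qed
  have leibniz: "V (L W (\<lambda>q. f q * h q)) =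
      f (\<lambda>_. 0) * V (L W h) + W h * V f + (h (\<lambda>_. 0) * V (L W f) + W f * V h)"
    if V: "V \<in> tangent aff_mfd (\<lambda>_. 0)" and W: "W \<in> tangent aff_mfd (\<lambda>_. 0)"
      and f: "f \<in> Cinf aff_mfd" and h: "h \<in> Cinf aff_mfd" for V W f h
  proof -
    have "V (L W (\<lambda>q. f q * h q)) = V (\<lambda>a. 1 * (f a * L W h a) + 1 * (h a * L W f a))"
      unfolding L_def
      by (rule AM.tangent_local[OF V]) (simp_all add: AM.tangent_mult[OF W trans[OF f] trans[OF h]])
    also have "\<dots> = V (\<lambda>a. f a * L W h a) + V (\<lambda>a. h a * L W f a)"
      using AM.tangent_lincomb[OF V AM.Cinf_mult[OF f L_Cinf[OF W h]]
          AM.Cinf_mult[OF h L_Cinf[OF W f]], of 1 1] by simp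
    finally show ?thesis
      by (simp add: AM.tangent_mult[OF V f L_Cinf[OF W h]] AM.tangent_mult[OF V h L_Cinf[OF W f]]
          L_one[OF W])
  qed
  have bracket: "lie_bracket aff aff_mfd Y U f = Y (L U f) - U (L Y f)" if "f \<in> Cinf aff_mfd" for f
    using that by (simp add: lie_bracket_def L_def[abs_def])
  show ?thesis
    unfolding tangent_def mem_Collect_eq
  proof (intro conjI ballI allI impI)
    show "lie_bracket aff aff_mfd Y U f = 0" if "f \<notin> Cinf aff_mfd" for f
      using that by (simp add: lie_bracket_def)
    fix f h
    assume f: "f \<in> Cinf aff_mfd" and h: "h \<in> Cinf aff_mfd"
    show "lie_bracket aff aff_mfd Y U (\<lambda>q. r * f q + s * h q) =
        r * lie_bracket aff aff_mfd Y U f + s * lie_bracket aff aff_mfd Y U h" for r s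
      unfolding bracket[OF f] bracket[OF h] bracket[OF AM.Cinf_lincomb[OF f h]]
        lincomb[OF Y U f h] lincomb[OF U Y f h] by (simp add: algebra_simps)
    show "lie_bracket aff aff_mfd Y U (\<lambda>q. f q * h q) =
        f (\<lambda>_. 0) * lie_bracket aff aff_mfd Y U h + h (\<lambda>_. 0) * lie_bracket aff aff_mfd Y U f"
      unfolding bracket[OF f] bracket[OF h] bracket[OF AM.Cinf_mult[OF f h]]
        leibniz[OF Y U f h] leibniz[OF U Y f h] by (simp add: algebra_simps)
  qed
qed

section \<open>The hyperbolic metric\<close>

text \<open>The metric \<open>e\<^sup>-\<^sup>2\<^sup>t ds\<^sup>2 + dt\<^sup>2\<close>: with \<open>u = e\<^sup>t\<close> this is \<open>(ds\<^sup>2 + du\<^sup>2) / u\<^sup>2\<close>, the upper half plane. Left translation by \<open>a\<close>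
  stretches the direction \<open>s\<close> by \<open>e\<close> to the power \<open>a 1\<close>, which the first coefficient compensates.\<close>

definition hyp_coeff :: "coord \<Rightarrow> nat \<Rightarrow> real" where
  "hyp_coeff x i = (if i = 0 then exp (- 2 * x 1) else 1)"

definition hyp_metric :: "coord set \<Rightarrow> coord set tvec \<Rightarrow> coord set tvec \<Rightarrow> real" where
  "hyp_metric \<xi> = HQ.diagonal_form (hyp_coeff (the_elem \<xi>))"

definition aff_inner :: "coord tvec \<Rightarrow> coord tvec \<Rightarrow> real" where
  "aff_inner = AM.diagonal_form (\<lambda>_. 1)"

lemma hyp_coeff_pos: "hyp_coeff x i > 0"
  by (simp add: hyp_coeff_def)

lemma hyp_coeff_zero: "hyp_coeff (\<lambda>_. 0) = (\<lambda>_. 1)"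
  by (simp add: hyp_coeff_def fun_eq_iff)

lemma smooth_hyp_coeff: "smooth_on 2 (cspace 2) (\<lambda>x. hyp_coeff x i)"
  unfolding hyp_coeff_def
  by (cases "i = 0") (simp_all only: simp_thms if_True if_False smooth_mult smooth_exp smooth_coord smooth_const)

lemma hyp_metric_coord_vec:
  assumes "x \<in> cspace 2" "i < 2" "j < 2"
  shows "hyp_metric (HQ.\<phi>i x) (coord_vec hyp_plane HQ.ch x i) (coord_vec hyp_plane HQ.ch x j) =
    (if i = j then hyp_coeff x i else 0)"
  using HQ.diagonal_form_coord_vec[of x i j] HQ.chart_inv_right[of x] assms
  by (simp add: hyp_metric_def)

lemma riemannian_hyp: "riemannian_metric hyp_plane hyp_metric"
proof -
  have "smooth_on 2 (cspace 2)
      (\<lambda>x. hyp_metric (HQ.\<phi>i x) (coord_vec hyp_plane HQ.ch x i) (coord_vec hyp_plane HQ.ch x j))"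
    if "i < 2" "j < 2" for i j
    using smooth_on_cong[of 2 "\<lambda>x. hyp_metric (HQ.\<phi>i x) (coord_vec hyp_plane HQ.ch x i) (coord_vec hyp_plane HQ.ch x j)"
        "\<lambda>x. if i = j then hyp_coeff x i else 0"] hyp_metric_coord_vec[OF _ that]
    by (cases "i = j") (simp_all add: smooth_hyp_coeff smooth_const)
  moreover have "inner_product_on (tangent hyp_plane p) (hyp_metric p)" if "p \<in> HQ.S" for p
    unfolding hyp_metric_def using HQ.inner_product_diagonal_form[OF that] hyp_coeff_pos by blast
  ultimately show ?thesis
    unfolding riemannian_metric_def HQ.atlas using HQ.chart_image by simp
qed

lemma differential_translation_coord:
  assumes a: "a \<in> cspace 2" and b: "b \<in> cspace 2" and v: "v \<in> tangent hyp_plane {b}"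
  shows "differential hyp_plane (translation aff a) v (\<lambda>q. the_elem q j) =
    (if j = 0 then exp (a 1) else 1) * v (\<lambda>q. the_elem q j)"
proof -
  let ?e = "if j = 0 then exp (a 1) else 1 :: real"
  have "differential hyp_plane (translation aff a) v (\<lambda>q. the_elem q j) =
      v (\<lambda>\<xi>. the_elem (translation aff a \<xi>) j)"
    by (rule differential_apply[OF HQ.Cinf_coord])
  also have "\<dots> = v (\<lambda>q. ?e * the_elem q j + a j * 1)"
    using b by (intro HQ.tangent_local[OF v]) (auto simp: translation_aff aff_mult_affine[OF a])
  also have "\<dots> = ?e * v (\<lambda>q. the_elem q j)"
    using HQ.tangent_lincomb[OF v HQ.Cinf_coord[of j] HQ.Cinf_const[of 1], where a = ?e and b = "a j"]
      HQ.tangent_const[OF v] by simp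
  finally show ?thesis .
qed

lemma invariant_hyp: "invariant_metric aff hyp_plane hyp_metric"
  unfolding invariant_metric_def
proof (intro ballI)
  fix a \<xi> v w
  assume "a \<in> carrier aff" "\<xi> \<in> topspace (mtop hyp_plane)"
    and v: "v \<in> tangent hyp_plane \<xi>" and w: "w \<in> tangent hyp_plane \<xi>"
  then obtain b where a: "a \<in> cspace 2" and b: "b \<in> cspace 2" and \<xi>: "\<xi> = {b}"
    by auto
  have "exp (- 2 * (a 1 + b 1)) * (exp (a 1) * r) * (exp (a 1) * s) = exp (- 2 * b 1) * r * s" for r s
  proof -
    have "exp (- 2 * (a 1 + b 1)) * exp (a 1) * exp (a 1) = exp (- 2 * b 1)"
      by (simp add: exp_add[symmetric])
    then show ?thesis
      by (metis mult.assoc mult.left_commute)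
  qed
  then show "hyp_metric (translation aff a \<xi>) (differential hyp_plane (translation aff a) v)
      (differential hyp_plane (translation aff a) w) = hyp_metric \<xi> v w"
    unfolding hyp_metric_def HQ.diagonal_form_def hyp_simps
    by (simp add: differential_translation_coord[OF a b v[unfolded \<xi>]]
        differential_translation_coord[OF a b w[unfolded \<xi>]] \<xi> translation_aff hyp_coeff_def
        aff_mult_def numeral_2_eq_2)
qed

lemma orth_complement_aff:
  "orth_complement aff aff_mfd {\<lambda>_. 0} aff_inner = tangent aff_mfd (\<lambda>_. 0)"
  by (auto simp: orth_complement_def subgroup_lie_algebra_trivial aff_inner_def AM.diagonal_form_def)

lemma reductive_riemannian_hyp:
  "reductive_riemannian aff aff_mfd {\<lambda>_. 0} hyp_plane aff_inner hyp_metric"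
  unfolding reductive_riemannian_def
proof (intro conjI ballI)
  show "subgroup {\<lambda>_. 0} aff"
    using group.triv_subgroup[OF aff_group] by simp
  show "closedin (mtop aff_mfd) {\<lambda>_. 0}"
    using closedin_Hausdorff_singleton[OF Hausdorff_Euclidean_space zero_cspace] by simp
  show "connected_space (mtop aff_mfd)"
    by (simp add: connected_Euclidean_space)
  show "inner_product_on (lie_algebra aff aff_mfd) aff_inner"
    using AM.inner_product_diagonal_form[of "\<lambda>_. 0" "\<lambda>_. 1"] by (simp add: aff_inner_def)
  show "reductive_decomposition aff aff_mfd {\<lambda>_. 0} (orth_complement aff aff_mfd {\<lambda>_. 0} aff_inner)"
    unfolding reductive_decomposition_def orth_complement_aff subgroup_lie_algebra_trivial aff_simps
    using AM.subspace_tangent AM.tangent_zero by (auto simp: Ad_one)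
  show "hyp_metric {\<lambda>_. 0} (tangent_proj aff {\<lambda>_. 0} hyp_plane v) (tangent_proj aff {\<lambda>_. 0} hyp_plane w) =
      aff_inner v w"
    if "v \<in> orth_complement aff aff_mfd {\<lambda>_. 0} aff_inner"
      "w \<in> orth_complement aff aff_mfd {\<lambda>_. 0} aff_inner" for v w
    using that unfolding orth_complement_aff
    by (simp add: hyp_metric_def aff_inner_def HQ.diagonal_form_def AM.diagonal_form_def
        tangent_proj_coord[OF _ zero_cspace] hyp_coeff_zero)
qed (fact lie_group_aff homogeneous_manifold_hyp riemannian_hyp invariant_hyp)+

lemma proj_h_aff:
  assumes "W \<in> tangent aff_mfd (\<lambda>_. 0)"
  shows "proj_h aff aff_mfd {\<lambda>_. 0} aff_inner W = 0"
  unfolding proj_h_def orth_complement_aff subgroup_lie_algebra_trivial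
  using assms by (intro the_equality) auto

lemma lie_bracket_zero:
  assumes "Y \<in> tangent aff_mfd (\<lambda>_. 0)"
  shows "lie_bracket aff aff_mfd 0 Y = 0"
  using AM.tangent_const[OF assms, of 0] by (auto simp: lie_bracket_def fun_eq_iff)

section \<open>Curvature of the hyperbolic metric\<close>

lemma inverse_matrix_diagonal:
  assumes m: "\<And>i j. i < n \<Longrightarrow> j < n \<Longrightarrow> m i j = (if i = j then a i else 0)"
    and a: "\<And>i. i < n \<Longrightarrow> a i \<noteq> 0"
  shows "inverse_matrix n m = (\<lambda>i j. if i = j \<and> i < n then 1 / a i else 0)"
proof -
  have row: "(\<Sum>k<n. m i k * b k j) = a i * b i j" if "i < n" for i j b
  proof -
    have "(\<Sum>k<n. m i k * b k j) = (\<Sum>k<n. if k = i then a i * b i j else 0)"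
      using that by (intro sum.cong) (auto simp: m)
    then show ?thesis using that by simp
  qed
  show ?thesis
    unfolding inverse_matrix_def
  proof (rule the_equality)
    have "(\<Sum>k<n. m i k * (if k = j \<and> k < n then 1 / a k else 0)) = (if i = j then 1 else 0)"
      if "i < n" for i j
      using row[OF that, of "\<lambda>i j. if i = j \<and> i < n then 1 / a i else 0" j] a that by simp
    then show "(\<forall>i<n. \<forall>j<n. (\<Sum>k<n. m i k * (if k = j \<and> k < n then 1 / a k else 0)) =
        (if i = j then 1 else 0)) \<and>
      (\<forall>i j. i \<ge> n \<or> j \<ge> n \<longrightarrow> (if i = j \<and> i < n then 1 / a i else 0) = 0)"
      by auto
  next
    fix b
    assume b: "(\<forall>i<n. \<forall>j<n. (\<Sum>k<n. m i k * b k j) = (if i = j then 1 else 0)) \<and>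
      (\<forall>i j. i \<ge> n \<or> j \<ge> n \<longrightarrow> b i j = 0)"
    show "b = (\<lambda>i j. if i = j \<and> i < n then 1 / a i else 0)"
    proof (intro ext)
      fix i j
      show "b i j = (if i = j \<and> i < n then 1 / a i else 0)"
      proof (cases "i < n \<and> j < n")
        case True
        then have "a i * b i j = (if i = j then 1 else 0)"
          using b row by metis
        then show ?thesis
          using True a[of i] by (auto simp: field_simps split: if_splits)
      qed (use b in auto)
    qed
  qed
qed

text \<open>The Christoffel symbols of that metric: \<open>\<Gamma>\<^sup>s\<^sub>s\<^sub>t = \<Gamma>\<^sup>s\<^sub>t\<^sub>s = -1\<close> and \<open>\<Gamma>\<^sup>t\<^sub>s\<^sub>s = e\<^sup>-\<^sup>2\<^sup>t\<close>.\<close>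

definition hyp_gamma :: "coord \<Rightarrow> nat \<Rightarrow> nat \<Rightarrow> nat \<Rightarrow> real" where
  "hyp_gamma x i j k =
     (if i = 0 then (if j \<noteq> k then - 1 else 0)
      else (if j = 0 \<and> k = 0 then exp (- 2 * x 1) else 0))"

lemma pd_hyp_coeff:
  "pd k (\<lambda>x. hyp_coeff x i) x = (if i = 0 \<and> k = 1 then - 2 * exp (- 2 * x 1) else 0)"
proof (cases "i = 0")
  case True
  show ?thesis
    unfolding hyp_coeff_def True by (rule pd_eqI) (auto intro!: derivative_eq_intros)
qed (simp add: hyp_coeff_def pd_const)

lemma sum_lessThan_2: "(\<Sum>i<2. f i) = f 0 + f (1::nat)"
  by (simp add: numeral_2_eq_2)

text \<open>The Gram matrix of the metric is known only at points of the coordinate space and for indices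
  below 2; this determines all derivatives that enter the Christoffel symbols.\<close>

lemma christoffel_hyp:
  assumes G: "\<And>x i j. x \<in> cspace 2 \<Longrightarrow> i < 2 \<Longrightarrow> j < 2 \<Longrightarrow> G x i j = (if i = j then hyp_coeff x i else 0)"
    and x: "x \<in> cspace 2" and "i < 2" "j < 2" "k < 2"
  shows "christoffel 2 G x i j k = hyp_gamma x i j k"
proof -
  have inv: "inverse_matrix 2 (G x) = (\<lambda>i j. if i = j \<and> i < 2 then 1 / hyp_coeff x i else 0)"
    by (rule inverse_matrix_diagonal) (simp_all add: G x hyp_coeff_def)
  have pd: "pd l (\<lambda>x. G x r s) x = (if r = 0 \<and> s = 0 \<and> l = 1 then - 2 * exp (- 2 * x 1) else 0)"
    if "l < 2" "r < 2" "s < 2" for l r s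
  proof -
    have "pd l (\<lambda>x. G x r s) x = pd l (\<lambda>x. if r = s then hyp_coeff x r else 0) x"
      by (rule pd_cong[OF _ that(1) x]) (rule G[OF _ that(2,3)])
    then show ?thesis
      by (cases "r = s") (auto simp: pd_hyp_coeff pd_const)
  qed
  have "exp (2 * x 1) * exp (- 2 * x 1) = 1"
    by (simp add: exp_add[symmetric])
  then show ?thesis
    unfolding christoffel_def inv using assms(3-5)
    by (auto simp: pd hyp_gamma_def hyp_coeff_def numeral_2_eq_2 less_Suc_eq)
qed

text \<open>With \<open>\<Gamma>\<^sup>s\<^sub>j\<^sub>k\<close> constant, the only contribution is \<open>- \<Gamma>\<^sup>s\<^sub>s\<^sub>t \<Gamma>\<^sup>s\<^sub>t\<^sub>s\<close>. For \<open>Y = \<partial>\<^sub>t\<close> and \<open>U = \<partial>\<^sub>s\<close>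
  this is the only component of the curvature tensor that the sectional curvature at the identity needs.\<close>

lemma curvature_hyp:
  assumes G: "\<And>x i j. x \<in> cspace 2 \<Longrightarrow> i < 2 \<Longrightarrow> j < 2 \<Longrightarrow> G x i j = (if i = j then hyp_coeff x i else 0)"
    and x: "x \<in> cspace 2"
  shows "levi_civita_curvature 2 G x 0 1 0 1 = - 1"
proof -
  have pd: "pd l (\<lambda>x. christoffel 2 G x 0 j k) x = 0" if "l < 2" "j < 2" "k < 2" for l j k
  proof -
    have "pd l (\<lambda>x. christoffel 2 G x 0 j k) x = pd l (\<lambda>x. hyp_gamma x 0 j k) x"
      by (rule pd_cong[OF _ that(1) x]) (rule christoffel_hyp[OF G _ _ that(2,3)], auto)
    then show ?thesis
      by (simp add: hyp_gamma_def pd_const)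
  qed
  show ?thesis
    unfolding levi_civita_curvature_def
    by (simp add: pd christoffel_hyp[OF G x] sum_lessThan_2) (simp add: hyp_gamma_def)
qed

abbreviation aff_proj where "aff_proj \<equiv> tangent_proj aff {\<lambda>_. 0} hyp_plane"

lemma sectional_curvature_hyp:
  assumes Y: "Y \<in> tangent aff_mfd (\<lambda>_. 0)" "Y (\<lambda>q. q 0) = 0" "Y (\<lambda>q. q 1) = 1"
    and U: "U \<in> tangent aff_mfd (\<lambda>_. 0)" "U (\<lambda>q. q 0) = 1" "U (\<lambda>q. q 1) = 0"
  shows "sectional_curvature hyp_plane hyp_metric {\<lambda>_. 0} (aff_proj Y) (aff_proj U) = - 1"
proof -
  let ?o = "\<lambda>_. 0 :: real"
  let ?G = "\<lambda>x i j. hyp_metric (HQ.\<phi>i x) (coord_vec hyp_plane HQ.ch x i) (coord_vec hyp_plane HQ.ch x j)"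
  have mem: "{?o} \<in> HQ.S"
    by simp
  have comp: "components hyp_plane HQ.ch {?o} (aff_proj v) = (\<lambda>i. if i < 2 then v (\<lambda>q. q i) else 0)"
    if "v \<in> tangent aff_mfd ?o" for v
    using HQ.components_eq[OF mem tangent_proj_mem[OF that zero_cspace]] tangent_proj_coord[OF that zero_cspace]
    by (simp cong: if_cong)
  have metric: "hyp_metric {?o} v w = v (\<lambda>q. the_elem q 0) * w (\<lambda>q. the_elem q 0) +
      v (\<lambda>q. the_elem q 1) * w (\<lambda>q. the_elem q 1)" for v w
    by (simp add: hyp_metric_def HQ.diagonal_form_def hyp_coeff_def numeral_2_eq_2)
  have "levi_civita_curvature 2 ?G ?o 0 1 0 1 = - 1"
    by (rule curvature_hyp[OF hyp_metric_coord_vec zero_cspace])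
  then have R: "of_components hyp_plane HQ.ch ?o (\<lambda>i. \<Sum>j<2. \<Sum>k<2. \<Sum>l<2.
      (if j < 2 then Y (\<lambda>q. q j) else 0) * levi_civita_curvature 2 ?G ?o i j k l *
      (if k < 2 then U (\<lambda>q. q k) else 0) * (if l < 2 then Y (\<lambda>q. q l) else 0)) (\<lambda>q. the_elem q 0) = - 1"
    using HQ.of_components_coord[of ?o 0] Y U by (simp add: numeral_2_eq_2)
  show ?thesis
    unfolding sectional_curvature_def Let_def HQ.chart_at_eq[OF mem] comp[OF Y(1)] comp[OF U(1)]
      fst_conv snd_conv metric hyp_simps(2)
    using R by (simp add: tangent_proj_coord[OF Y(1) zero_cspace]
        tangent_proj_coord[OF U(1) zero_cspace] Y[unfolded One_nat_def] U[unfolded One_nat_def])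
qed

section \<open>The counterexample\<close>

theorem mainTheorem3:
  "\<not> (\<forall>(G :: (nat \<Rightarrow> real) monoid) M H Q ip g.
        reductive_riemannian G M H Q ip g \<longrightarrow>
        (\<forall>X\<in>randers_vectors G M H ip. \<forall>Y\<in>orth_complement G M H ip. \<forall>P U.
           Y \<noteq> 0 \<and> subspace P \<and> dim P = 2 \<and> P \<subseteq> orth_complement G M H ip \<and>
           Y \<in> P \<and> U \<in> P \<and> span {Y, U} = P \<longrightarrow>
           flag_curvature Q (randers_metric G H Q g X) H (tangent_proj G H Q Y) (tangent_proj G H Q U)
             = 2 * sqrt (ip Y Y) / (2 * sqrt (ip Y Y) + ip X Y)
               * sectional_curvature Q g H (tangent_proj G H Q Y) (tangent_proj G H Q U) \<and>
           sectional_curvature Q g H (tangent_proj G H Q Y) (tangent_proj G H Q U)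
             = ip (lie_bracket G M (proj_h G M H ip (lie_bracket G M Y U)) Y) U
               / (ip U U * ip Y Y - (ip U Y)\<^sup>2)))"
proof
  assume *: "\<forall>(G :: (nat \<Rightarrow> real) monoid) M H Q ip g.
        reductive_riemannian G M H Q ip g \<longrightarrow>
        (\<forall>X\<in>randers_vectors G M H ip. \<forall>Y\<in>orth_complement G M H ip. \<forall>P U.
           Y \<noteq> 0 \<and> subspace P \<and> dim P = 2 \<and> P \<subseteq> orth_complement G M H ip \<and>
           Y \<in> P \<and> U \<in> P \<and> span {Y, U} = P \<longrightarrow>
           flag_curvature Q (randers_metric G H Q g X) H (tangent_proj G H Q Y) (tangent_proj G H Q U)
             = 2 * sqrt (ip Y Y) / (2 * sqrt (ip Y Y) + ip X Y)
               * sectional_curvature Q g H (tangent_proj G H Q Y) (tangent_proj G H Q U) \<and>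
           sectional_curvature Q g H (tangent_proj G H Q Y) (tangent_proj G H Q U)
             = ip (lie_bracket G M (proj_h G M H ip (lie_bracket G M Y U)) Y) U
               / (ip U U * ip Y Y - (ip U Y)\<^sup>2))"
  let ?o = "\<lambda>_. 0 :: real"
  let ?T = "tangent aff_mfd ?o"
  define U Y where "U = coord_vec aff_mfd AM.ch ?o 0" and "Y = coord_vec aff_mfd AM.ch ?o 1"
  have T: "U \<in> ?T" "Y \<in> ?T"
    using AM.coord_vec_tangent[of ?o] AM_inv[of ?o] by (simp_all add: U_def Y_def)
  have vals: "U (\<lambda>q. q 0) = 1" "U (\<lambda>q. q 1) = 0" "Y (\<lambda>q. q 0) = 0" "Y (\<lambda>q. q 1) = 1"
    using AM.coord_vec_coord[of ?o] by (simp_all add: U_def Y_def)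
  have "Y \<notin> span {U}" "U \<noteq> 0"
    using vals by (auto simp: span_singleton scaleR_fun_def)
  then have indep: "independent {Y, U}" and "Y \<noteq> U"
    by (auto simp: independent_insert span_base)
  have "dim (span {Y, U}) = 2"
    using dim_span_eq_card_independent[OF indep] \<open>Y \<noteq> U\<close> by simp
  moreover have "span {Y, U} \<subseteq> ?T"
    using T by (intro span_minimal AM.subspace_tangent) auto
  moreover have "Y \<noteq> 0"
    using vals(4) by auto
  ultimately have plane: "Y \<noteq> 0 \<and> subspace (span {Y, U}) \<and> dim (span {Y, U}) = 2 \<and>
      span {Y, U} \<subseteq> orth_complement aff aff_mfd {?o} aff_inner \<and>
      Y \<in> span {Y, U} \<and> U \<in> span {Y, U} \<and> span {Y, U} = span {Y, U}"
    by (simp add: orth_complement_aff span_base subspace_span)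
  have zero: "0 \<in> randers_vectors aff aff_mfd {?o} aff_inner"
    unfolding randers_vectors_def orth_complement_aff
    using Ad_one[OF AM.tangent_zero] AM.tangent_zero by (auto simp: aff_inner_def AM.diagonal_form_def)
  have Y: "Y \<in> orth_complement aff aff_mfd {?o} aff_inner"
    unfolding orth_complement_aff by (rule T)
  note instance_aff = *[THEN spec[of _ aff], THEN spec[of _ aff_mfd], THEN spec[of _ "{?o}"],
      THEN spec[of _ hyp_plane], THEN spec[of _ aff_inner], THEN spec[of _ hyp_metric], THEN mp,
      OF reductive_riemannian_hyp]
  have formula: "sectional_curvature hyp_plane hyp_metric {?o} (aff_proj Y) (aff_proj U) =
      aff_inner (lie_bracket aff aff_mfd (proj_h aff aff_mfd {?o} aff_inner (lie_bracket aff aff_mfd Y U)) Y) U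
        / (aff_inner U U * aff_inner Y Y - (aff_inner U Y)\<^sup>2)" (is "_ = ?rhs")
    by (rule instance_aff[THEN bspec, OF zero, THEN bspec, OF Y, THEN spec[of _ "span {Y, U}"],
          THEN spec[of _ U], THEN mp, OF plane, THEN conjunct2])
  have rhs_zero: "?rhs = 0"
    unfolding proj_h_aff[OF lie_bracket_tangent[OF T(2,1)]] lie_bracket_zero[OF T(2)]
    by (simp add: aff_inner_def AM.diagonal_form_def)
  have "?rhs = - 1"
    unfolding formula[symmetric] using sectional_curvature_hyp[of Y U] T vals by blast
  from trans[OF rhs_zero[symmetric] this] show False
    by simp
qed

end
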